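(* Let $F:M\to\mathbf{E}^3_1$ be a timelike surface with harmonic inverse mean curvature, let $(u,v)$ be a null coordinate system on a simply connected coordinate region, with $I=e^{\omega}\,du\,dv$, $Q=\langle F_{uu},N\rangle$, $R=\langle F_{vv},N\rangle$, and write the mean curvature as $$H=\frac{1}{f(u)+g(v)}$$ with smooth functions $f(u)$, $g(v)$. For $\tau\in\mathbf{R}$ with $1+2\tau f$ and $1-2\tau g$ nowhere zero put $$\lambda=\lambda(u,v;\tau)=\frac{1-2\tau g(v)}{1+2\tau f(u)} .$$ Then $F$ admits the following Lax representation with variable spectral parameter $\lambda$: the system $$\frac{\partial}{\partial u}\Phi_\lambda=\Phi_\lambda U_\lambda,\qquad \frac{\partial}{\partial v}\Phi_\lambda=\Phi_\lambda V_\lambda,$$ $$U_\lambda=\begin{pmatrix}-\frac14\omega_u & -Qe^{-\omega/2}\\ \frac H2\lambda e^{\omega/2} & \frac14\omega_u\end{pmatrix},\qquad V_\lambda=\begin{pmatrix}\frac14\omega_v & -\frac H2\lambda^{-1}e^{\omega/2}\\ Re^{-\omega/2} & -\frac14\omega_v\end{pmatrix}$$ is compatible, i.e. $\partial_uV_\lambda-\partial_vU_\lambda+[U_\lambda,V_\lambda]=0$. Let $\Phi_\lambda(u,v)$ be an $\mathrm{SL}_2\mathbf{R}$-valued solution of this system, depending smoothly on $\tau$. Then $$F_\lambda=-\frac{\partial}{\partial\tau}\Phi_\lambda\cdot\Phi_\lambda^{-1}$$ describes a family of timelike surfaces in $\mathbf{E}^3_1$ with harmonic inverse mean curvature, with $F_\lambda|_{\tau=0}$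 equal to $F$ up to an isometry of $\mathbf{E}^3_1$, with Gauss map (unit normal) $N_\lambda=\mathrm{Ad}(\Phi_\lambda)\mathbf{k}'$. The first fundamental form $I_\lambda$, mean curvature $H_\lambda$, Hopf differential coefficients $Q_\lambda,R_\lambda$ and Gaussian curvature $K_\lambda$ of $F_\lambda$ are $$I_\lambda=\frac{e^{\omega}\,du\,dv}{(1+2\tau f)^2(1-2\tau g)^2},$$ $$\frac1{H_\lambda}=f_\lambda+g_\lambda,\qquad f_\lambda=\frac{f}{1+2\tau f},\qquad g_\lambda=\frac{g}{1-2\tau g},$$ $$Q_\lambda=\frac{Q}{(1+2\tau f)^2},\qquad R_\lambda=\frac{R}{(1-2\tau g)^2},$$ $$K_\lambda=(1+2\tau f)^2(1-2\tau g)^2K,$$ where $K$ is the Gaussian curvature of $F$, and consequently $H_\lambda^2/K_\lambda\equiv H^2/K$ (where $K\neq0$).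
   Context: $\mathbf{E}^3_1$ is Minkowski 3-space, identified with the Lie algebra $\mathfrak{sl}_2\mathbf{R}$ of trace-free real $2\times2$ matrices with scalar product $\langle X,Y\rangle=\frac12\mathrm{tr}(XY)$; $\mathrm{Ad}(a)X=aXa^{-1}$, and $\mathbf{k}'=\begin{pmatrix}-1&0\\0&1\end{pmatrix}$. A timelike surface is an immersion $F:M\to\mathbf{E}^3_1$ of a connected orientable 2-manifold whose induced metric $I$ is Lorentzian; $N$ is a unit normal field. A null coordinate system is a local coordinate system $(u,v)$ with $I=e^\omega du\,dv$ (so $2\langle F_u,F_v\rangle=e^\omega$). The second fundamental form is $-\langle dF,dN\rangle$, the shape operator is $S=-dN$, $H=\frac12\mathrm{tr}\,S$, and $K=\det S$ is the Gaussian curvature. The surface (with $H$ nowhere zero) is said to have harmonic inverse mean curvature (THIMC surface) if $(1/H)_{uv}=0$ in null coordinates. *)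

theory Defs
  imports "HOL-Analysis.Analysis"
begin

text \<open>
  Iterated within-derivatives. On an open set this is the usual notion; on a product of a
  nondegenerate interval with an open set (where within-derivatives are still unique) it is
  smoothness with one-sided derivatives at the end points of the interval.
\<close>

fun Ck_on :: "nat \<Rightarrow> 'a::euclidean_space set \<Rightarrow> ('a \<Rightarrow> 'b::real_normed_vector) \<Rightarrow> bool" where
  "Ck_on 0 S h \<longleftrightarrow> continuous_on S h"
| "Ck_on (Suc k) S h \<longleftrightarrow>
     h differentiable_on S \<and> (\<forall>d. Ck_on k S (\<lambda>x. frechet_derivative h (at x within S) d))"

definition smooth_on :: "'a::euclidean_space set \<Rightarrow> ('a \<Rightarrow> 'b::real_normed_vector) \<Rightarrow> bool" where
  "smooth_on S h \<longleftrightarrow> (\<forall>k. Ck_on k S h)"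

text \<open>Coordinates are \<open>u = p $ 1\<close> and \<open>v = p $ 2\<close>.\<close>

definition partial :: "2 \<Rightarrow> (real^2 \<Rightarrow> 'b::real_normed_vector) \<Rightarrow> real^2 \<Rightarrow> 'b" where
  "partial i h p = frechet_derivative h (at p) (axis i 1)"

definition mat2 :: "real \<Rightarrow> real \<Rightarrow> real \<Rightarrow> real \<Rightarrow> real^2^2" where
  "mat2 a b c d = vector [vector [a, b], vector [c, d]]"

text \<open>Minkowski 3-space is the subspace \<open>sl2\<close> of \<open>real^2^2\<close> with the form \<open>mink\<close>.\<close>

definition sl2 :: "(real^2^2) set" where
  "sl2 = {X. trace X = 0}"

definition mink :: "real^2^2 \<Rightarrow> real^2^2 \<Rightarrow> real" where
  "mink X Y = trace (X ** Y) / 2"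

definition Ad :: "real^2^2 \<Rightarrow> real^2^2 \<Rightarrow> real^2^2" where
  "Ad a X = a ** X ** matrix_inv a"

definition k' :: "real^2^2" where
  "k' = mat2 (-1) 0 0 1"

definition mink_isometry :: "(real^2^2 \<Rightarrow> real^2^2) \<Rightarrow> bool" where
  "mink_isometry T \<longleftrightarrow> (\<exists>A b. linear A \<and> A ` sl2 \<subseteq> sl2 \<and> b \<in> sl2 \<and>
     (\<forall>X\<in>sl2. \<forall>Y\<in>sl2. mink (A X) (A Y) = mink X Y) \<and> (\<forall>X\<in>sl2. T X = A X + b))"

definition first_form :: "(real^2 \<Rightarrow> real^2^2) \<Rightarrow> real^2 \<Rightarrow> real^2 \<Rightarrow> real^2 \<Rightarrow> real" where
  "first_form F p x y = mink (frechet_derivative F (at p) x) (frechet_derivative F (at p) y)"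

definition lorentzian :: "(real^2 \<Rightarrow> real^2 \<Rightarrow> real) \<Rightarrow> bool" where
  "lorentzian B \<longleftrightarrow> bilinear B \<and> (\<forall>x y. B x y = B y x) \<and>
     (\<exists>x y. B x x = -1 \<and> B y y = 1 \<and> B x y = 0)"

definition timelike_surface :: "(real^2) set \<Rightarrow> (real^2 \<Rightarrow> real^2^2) \<Rightarrow> bool" where
  "timelike_surface D F \<longleftrightarrow> open D \<and> connected D \<and> F ` D \<subseteq> sl2 \<and> smooth_on D F \<and>
     (\<forall>p\<in>D. inj (frechet_derivative F (at p)) \<and> lorentzian (first_form F p))"

definition unit_normal_field ::
    "(real^2) set \<Rightarrow> (real^2 \<Rightarrow> real^2^2) \<Rightarrow> (real^2 \<Rightarrow> real^2^2) \<Rightarrow> bool" where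
  "unit_normal_field D F N \<longleftrightarrow> smooth_on D N \<and> N ` D \<subseteq> sl2 \<and>
     (\<forall>p\<in>D. mink (N p) (N p) = 1 \<and> (\<forall>x. mink (frechet_derivative F (at p) x) (N p) = 0))"

text \<open>
  \<open>I = exp \<omega> du dv\<close> is read as an identity of quadratic forms, so that
  \<open>2 \<langle>F\<^sub>u, F\<^sub>v\<rangle> = exp \<omega>\<close>.
\<close>

definition null_coordinates ::
    "(real^2) set \<Rightarrow> (real^2 \<Rightarrow> real^2^2) \<Rightarrow> (real^2 \<Rightarrow> real) \<Rightarrow> bool" where
  "null_coordinates D F \<omega> \<longleftrightarrow> smooth_on D \<omega> \<and>
     (\<forall>p\<in>D. \<forall>x. first_form F p x x = exp (\<omega> p) * (x $ 1) * (x $ 2))"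

text \<open>
  \<open>S = - dN\<close> as an endomorphism of the coordinate tangent plane: tangent vectors of the
  surface are identified with \<open>real^2\<close> through \<open>dF\<close>.
\<close>

definition shape_operator ::
    "(real^2 \<Rightarrow> real^2^2) \<Rightarrow> (real^2 \<Rightarrow> real^2^2) \<Rightarrow> real^2 \<Rightarrow> real^2 \<Rightarrow> real^2" where
  "shape_operator F N p = (THE S. linear S \<and>
     (\<forall>x. frechet_derivative F (at p) (S x) = - frechet_derivative N (at p) x))"

definition mean_curvature ::
    "(real^2 \<Rightarrow> real^2^2) \<Rightarrow> (real^2 \<Rightarrow> real^2^2) \<Rightarrow> real^2 \<Rightarrow> real" where
  "mean_curvature F N p = trace (matrix (shape_operator F N p)) / 2"

definition gauss_curvature ::
    "(real^2 \<Rightarrow> real^2^2) \<Rightarrow> (real^2 \<Rightarrow> real^2^2) \<Rightarrow> real^2 \<Rightarrow> real" where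
  "gauss_curvature F N p = det (matrix (shape_operator F N p))"

definition hopf_Q ::
    "(real^2 \<Rightarrow> real^2^2) \<Rightarrow> (real^2 \<Rightarrow> real^2^2) \<Rightarrow> real^2 \<Rightarrow> real" where
  "hopf_Q F N p = mink (partial 1 (partial 1 F) p) (N p)"

definition hopf_R ::
    "(real^2 \<Rightarrow> real^2^2) \<Rightarrow> (real^2 \<Rightarrow> real^2^2) \<Rightarrow> real^2 \<Rightarrow> real" where
  "hopf_R F N p = mink (partial 2 (partial 2 F) p) (N p)"

definition thimc_surface ::
    "(real^2) set \<Rightarrow> (real^2 \<Rightarrow> real^2^2) \<Rightarrow> (real^2 \<Rightarrow> real^2^2) \<Rightarrow> bool" where
  "thimc_surface D F N \<longleftrightarrow>
     timelike_surface D F \<and> unit_normal_field D F N \<and> (\<exists>\<omega>. null_coordinates D F \<omega>) \<and>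
     (\<forall>p\<in>D. mean_curvature F N p \<noteq> 0 \<and>
        partial 2 (partial 1 (\<lambda>q. 1 / mean_curvature F N q)) p = 0)"

definition admissible :: "(real^2) set \<Rightarrow> (real \<Rightarrow> real) \<Rightarrow> (real \<Rightarrow> real) \<Rightarrow> real set" where
  "admissible D f g = {\<tau>. \<forall>p\<in>D. 1 + 2 * \<tau> * f (p $ 1) \<noteq> 0 \<and> 1 - 2 * \<tau> * g (p $ 2) \<noteq> 0}"

definition spectral :: "(real \<Rightarrow> real) \<Rightarrow> (real \<Rightarrow> real) \<Rightarrow> real \<Rightarrow> real^2 \<Rightarrow> real" where
  "spectral f g \<tau> p = (1 - 2 * \<tau> * g (p $ 2)) / (1 + 2 * \<tau> * f (p $ 1))"

definition lax_U :: "(real^2 \<Rightarrow> real^2^2) \<Rightarrow> (real^2 \<Rightarrow> real^2^2) \<Rightarrow> (real^2 \<Rightarrow> real) \<Rightarrow>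
    (real^2 \<Rightarrow> real) \<Rightarrow> real^2 \<Rightarrow> real^2^2" where
  "lax_U F N \<omega> l p = mat2
     (- (1/4) * partial 1 \<omega> p)                              (- hopf_Q F N p * exp (- \<omega> p / 2))
     (mean_curvature F N p / 2 * l p * exp (\<omega> p / 2))       (1/4 * partial 1 \<omega> p)"

definition lax_V :: "(real^2 \<Rightarrow> real^2^2) \<Rightarrow> (real^2 \<Rightarrow> real^2^2) \<Rightarrow> (real^2 \<Rightarrow> real) \<Rightarrow>
    (real^2 \<Rightarrow> real) \<Rightarrow> real^2 \<Rightarrow> real^2^2" where
  "lax_V F N \<omega> l p = mat2
     (1/4 * partial 2 \<omega> p)               (- (mean_curvature F N p / 2) * inverse (l p) * exp (\<omega> p / 2))
     (hopf_R F N p * exp (- \<omega> p / 2))    (- (1/4) * partial 2 \<omega> p)"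

definition lax_solution :: "(real^2) set \<Rightarrow> (real^2 \<Rightarrow> real^2^2) \<Rightarrow> (real^2 \<Rightarrow> real^2^2) \<Rightarrow>
    (real^2 \<Rightarrow> real) \<Rightarrow> (real^2 \<Rightarrow> real) \<Rightarrow> (real^2 \<Rightarrow> real^2^2) \<Rightarrow> bool" where
  "lax_solution D F N \<omega> l \<Phi> \<longleftrightarrow> (\<forall>p\<in>D. \<Phi> differentiable at p \<and>
     partial 1 \<Phi> p = \<Phi> p ** lax_U F N \<omega> l p \<and> partial 2 \<Phi> p = \<Phi> p ** lax_V F N \<omega> l p)"

definition sym_surface :: "real set \<Rightarrow> (real \<Rightarrow> real^2 \<Rightarrow> real^2^2) \<Rightarrow> real \<Rightarrow> real^2 \<Rightarrow> real^2^2" where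
  "sym_surface J \<Phi> \<tau> p =
     - (vector_derivative (\<lambda>t. \<Phi> t p) (at \<tau> within J) ** matrix_inv (\<Phi> \<tau> p))"

end

(*
  With a = 1 + 2 tau f and b = 1 - 2 tau g one has H lambda = H - 2 tau / a and
  H / lambda = H + 2 tau / b. Hence lambda drops out of the Gauss-Codazzi equations, which gives
  compatibility, and differentiating the Lax pair in tau gives
      d_u F_lambda = exp(omega/2) / a^2 Ad(Phi) E21,   d_v F_lambda = exp(omega/2) / b^2 Ad(Phi) E12.
  All fundamental data of F_lambda are read off from these two formulas by differentiating once more
  with the Lax pair. At tau = 0 the data are those of F, and the linear map sending the frame
  (F_u, F_v, N) to (F_lambda_u, F_lambda_v, N_lambda) is then constant, because both frames solve the
  same Gauss-Weingarten system.
*)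
theory Submission
  imports Defs
begin

section \<open>Functions of class C^k and smooth functions\<close>

text \<open>The spectral identities rest on \<open>a - b = 2 \<tau> (f + g) = 2 \<tau> / H\<close>:
  it is the additive form of \<open>1/H\<close> that makes \<open>\<lambda> = b/a\<close> shift
  \<open>H\<close> by a function of a single null coordinate. Since \<open>a - \<tau> a' = 1\<close>
  for the derivative \<open>a'\<close> of \<open>a\<close> in \<tau>, and likewise for
  \<open>b\<close>, the shifts \<open>- 2 \<tau> / a\<close> and \<open>2 \<tau> / b\<close> have
  derivatives \<open>- 2 / a^2\<close> and \<open>2 / b^2\<close>; these are the squares in the
  partials of the new surface. The analytic obstacle is that differentiating the Lax pair in \<tau>
  needs mixed partials of \<Phi> to commute on \<open>J \<times> D\<close>, where \<open>J\<close>
  may contain end points. Symmetry of second derivatives is therefore proved for within-derivatives,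
  by shrinking parallelograms that have the given point as a corner. The inverse of \<Phi> is
  replaced by the adjugate, which is linear in the entries, so no rule for differentiating inverse
  matrices is needed. The congruence at \<open>\<tau> = 0\<close> may reverse orientation: the side
  of \<open>N\<close> is not prescribed, whereas the new frame is conjugate, up to positive factors,
  to a fixed triple of matrices. \<open>mink_isometry\<close> admits both cases.\<close>

declare Ck_on.simps(2) [simp del]

text \<open>\<open>frechet_derivative\<close> is a choice operator, so it suffices that both
  functions have the same derivatives in the sense of \<open>has_derivative\<close>;
  differentiability is not at issue.\<close>

lemma frechet_derivative_within_cong:
  assumes "x \<in> S" "\<And>y. y \<in> S \<Longrightarrow> h y = h' y"
  shows "frechet_derivative h (at x within S) = frechet_derivative h' (at x within S)"
proof -
  have "(h has_derivative A) (at x within S) \<longleftrightarrow> (h' has_derivative A) (at x within S)" for A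
    using assms has_derivative_transform[of x S h h' A] has_derivative_transform[of x S h' h A] by metis
  then show ?thesis by (simp add: frechet_derivative_def)
qed

lemma Ck_on_cong:
  assumes "\<And>x. x \<in> S \<Longrightarrow> h x = h' x"
  shows "Ck_on k S h \<longleftrightarrow> Ck_on k S h'"
  using assms
proof (induction k arbitrary: h h')
  case 0
  then show ?case by (simp cong: continuous_on_cong)
next
  case (Suc k)
  have "h differentiable_on S \<longleftrightarrow> h' differentiable_on S"
    unfolding differentiable_on_def differentiable_def
    using Suc.prems has_derivative_transform by metis
  moreover have "Ck_on k S (\<lambda>x. frechet_derivative h (at x within S) d) \<longleftrightarrow>
      Ck_on k S (\<lambda>x. frechet_derivative h' (at x within S) d)" for d
  proof (rule Suc.IH)
    fix x assume "x \<in> S"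
    then show "frechet_derivative h (at x within S) d = frechet_derivative h' (at x within S) d"
      using frechet_derivative_within_cong[of x S h h'] Suc.prems by simp
  qed
  ultimately show ?case by (simp add: Ck_on.simps(2))
qed

lemma Ck_on_SucD: "Ck_on (Suc k) S h \<Longrightarrow> Ck_on k S h"
proof (induction k arbitrary: h)
  case 0
  then show ?case by (simp add: Ck_on.simps(2) differentiable_imp_continuous_on)
next
  case (Suc k)
  have "Ck_on (Suc k) S (\<lambda>x. frechet_derivative h (at x within S) d)" for d
    using Suc.prems unfolding Ck_on.simps(2)[of "Suc k"] by blast
  then have "Ck_on k S (\<lambda>x. frechet_derivative h (at x within S) d)" for d
    by (rule Suc.IH)
  moreover have "h differentiable_on S"
    using Suc.prems unfolding Ck_on.simps(2)[of "Suc k"] by blast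
  ultimately show ?case unfolding Ck_on.simps(2) by blast
qed

text \<open>Introduction rule behind the closure lemmas: exhibit a derivative explicitly and check
  each direction. Openness makes the derivative unique, so it agrees with the one chosen in
  \<open>Ck_on\<close>.\<close>

lemma Ck_on_SucI:
  assumes "open S" and D: "\<And>x. x \<in> S \<Longrightarrow> (h has_derivative h' x) (at x)"
    and C: "\<And>d. Ck_on k S (\<lambda>x. h' x d)"
  shows "Ck_on (Suc k) S h"
proof -
  have "h differentiable_on S"
    unfolding differentiable_on_def using D differentiableI has_derivative_at_withinI by blast
  moreover have "Ck_on k S (\<lambda>x. frechet_derivative h (at x within S) d)" for d
  proof -
    have "frechet_derivative h (at x within S) d = h' x d" if "x \<in> S" for x
      using frechet_derivative_at[OF D[OF that]] at_within_open[OF that \<open>open S\<close>] by simp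
    then show ?thesis
      using C[of d] Ck_on_cong[of S "\<lambda>x. frechet_derivative h (at x within S) d" "\<lambda>x. h' x d"] by blast
  qed
  ultimately show ?thesis unfolding Ck_on.simps(2) by blast
qed

lemma Ck_on_has_derivative:
  assumes "Ck_on (Suc k) S h" "x \<in> S"
  shows "(h has_derivative frechet_derivative h (at x within S)) (at x within S)"
  using assms unfolding Ck_on.simps(2) differentiable_on_def frechet_derivative_works by blast

lemma Ck_on_open_has_derivative:
  assumes "Ck_on (Suc k) S h" "x \<in> S" "open S"
  shows "(h has_derivative frechet_derivative h (at x)) (at x)"
  using Ck_on_has_derivative[OF assms(1,2)] at_within_open[OF assms(2,3)] by simp

lemma Ck_on_open_directional:
  assumes "Ck_on (Suc k) S h" "open S"
  shows "Ck_on k S (\<lambda>x. frechet_derivative h (at x) d)"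
proof -
  have "Ck_on k S (\<lambda>x. frechet_derivative h (at x within S) d)"
    using assms(1) unfolding Ck_on.simps(2) by blast
  moreover have "frechet_derivative h (at x within S) d = frechet_derivative h (at x) d" if "x \<in> S" for x
    by (simp only: at_within_open[OF that assms(2)])
  ultimately show ?thesis
    using Ck_on_cong[of S "\<lambda>x. frechet_derivative h (at x within S) d" "\<lambda>x. frechet_derivative h (at x) d"]
    by blast
qed

lemma Ck_on_const: "open S \<Longrightarrow> Ck_on k S (\<lambda>x. c)"
proof (induction k arbitrary: c)
  case (Suc k)
  then show ?case by (intro Ck_on_SucI[where h'="\<lambda>x d. 0"]) auto
qed simp

lemma Ck_on_add:
  assumes "open S" "Ck_on k S h" "Ck_on k S h'"
  shows "Ck_on k S (\<lambda>x. h x + h' x)"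
  using assms(2,3)
proof (induction k arbitrary: h h')
  case 0
  then show ?case by (simp add: continuous_on_add)
next
  case (Suc k)
  note D = Ck_on_open_has_derivative[OF _ _ assms(1)]
  note C = Ck_on_open_directional[OF _ assms(1)]
  show ?case
    by (rule Ck_on_SucI[OF assms(1) has_derivative_add[OF D[OF Suc.prems(1)] D[OF Suc.prems(2)]]])
       (intro Suc.IH C Suc.prems | assumption)+
qed

text \<open>By Leibniz the derivative is again a sum of values of \<open>B\<close>, so the induction
  closes once both factors are generalized. Products, matrix products and \<open>mink\<close> are
  all instances.\<close>

lemma Ck_on_bilinear:
  assumes "bounded_bilinear B" "open S" "Ck_on k S h" "Ck_on k S h'"
  shows "Ck_on k S (\<lambda>x. B (h x) (h' x))"
  using assms(3,4)
proof (induction k arbitrary: h h')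
  case 0
  then show ?case using bounded_bilinear.continuous_on[OF assms(1)] by simp
next
  case (Suc k)
  note D = Ck_on_open_has_derivative[OF _ _ assms(2)]
  note C = Ck_on_open_directional[OF _ assms(2)]
  show ?case
    by (rule Ck_on_SucI[OF assms(2) bounded_bilinear.FDERIV[OF assms(1) D[OF Suc.prems(1)] D[OF Suc.prems(2)]]])
       (intro Ck_on_add[OF assms(2)] Suc.IH C Ck_on_SucD[OF Suc.prems(1)] Ck_on_SucD[OF Suc.prems(2)] Suc.prems
         | assumption)+
qed

lemma Ck_on_linear:
  assumes "bounded_linear L" "open S" "Ck_on k S h"
  shows "Ck_on k S (\<lambda>x. L (h x))"
  using assms(3)
proof (induction k arbitrary: h)
  case 0
  then show ?case using bounded_linear.continuous_on[OF assms(1)] by simp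
next
  case (Suc k)
  show ?case
    by (rule Ck_on_SucI[OF assms(2) bounded_linear.has_derivative[OF assms(1)
            Ck_on_open_has_derivative[OF Suc.prems _ assms(2)]]])
       (intro Suc.IH Ck_on_open_directional Suc.prems assms(2) | assumption)+
qed

text \<open>Differentiating keeps the shape "function on \<open>T\<close> after the same affine
  map", so no general chain rule for \<open>Ck_on\<close> is needed. Only \<open>S\<close> is open:
  this admits slices of \<open>J \<times> D\<close> at an end point of \<open>J\<close>.\<close>

lemma Ck_on_compose_affine:
  assumes "open S" "bounded_linear L" and T: "\<And>x. x \<in> S \<Longrightarrow> c + L x \<in> T" and "Ck_on k T h"
  shows "Ck_on k S (\<lambda>x. h (c + L x))"
  using assms(4)
proof (induction k arbitrary: h)
  case 0
  have "continuous_on S (\<lambda>x. c + L x)"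
    by (intro continuous_intros linear_continuous_on assms(2))
  with 0 show ?case
    using continuous_on_compose2[of T h S "\<lambda>x. c + L x"] T by (simp add: image_subset_iff)
next
  case (Suc k)
  have "((\<lambda>x. h (c + L x)) has_derivative
      (\<lambda>d. frechet_derivative h (at (c + L x) within T) (L d))) (at x)" if "x \<in> S" for x
  proof -
    have "((\<lambda>x. c + L x) has_derivative L) (at x within S)"
      using has_derivative_add[OF has_derivative_const bounded_linear_imp_has_derivative[OF assms(2)]] by simp
    moreover have "(h has_derivative frechet_derivative h (at (c + L x) within T))
        (at (c + L x) within (\<lambda>x. c + L x) ` S)"
      by (rule has_derivative_subset[OF Ck_on_has_derivative[OF Suc.prems T[OF that]]]) (use T in auto)
    ultimately show ?thesis
      using has_derivative_in_compose[of "\<lambda>x. c + L x" L x S h] at_within_open[OF that assms(1)] by simp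
  qed
  moreover have "Ck_on k S (\<lambda>x. frechet_derivative h (at (c + L x) within T) (L d))" for d
    using Suc.IH[of "\<lambda>y. frechet_derivative h (at y within T) (L d)"] Suc.prems
    unfolding Ck_on.simps(2) by blast
  ultimately show ?case by (rule Ck_on_SucI[OF assms(1)])
qed

text \<open>The derivative contains \<open>inverse (h x)\<close> itself, to which the induction
  hypothesis applies with \<open>h\<close> unchanged.\<close>

lemma Ck_on_inverse:
  fixes h :: "'a::euclidean_space \<Rightarrow> real"
  assumes "open S" "Ck_on k S h" and nz: "\<And>x. x \<in> S \<Longrightarrow> h x \<noteq> 0"
  shows "Ck_on k S (\<lambda>x. inverse (h x))"
  using assms(2)
proof (induction k)
  case 0
  then show ?case using continuous_on_inverse[of S h] nz by auto
next
  case (Suc k)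
  have i: "Ck_on k S (\<lambda>x. inverse (h x))"
    by (rule Suc.IH[OF Ck_on_SucD[OF Suc.prems]])
  have "((\<lambda>x. inverse (h x)) has_derivative
      (\<lambda>d. - (inverse (h x) * frechet_derivative h (at x) d * inverse (h x)))) (at x)" if "x \<in> S" for x
    by (rule Deriv.has_derivative_inverse[OF nz[OF that] Ck_on_open_has_derivative[OF Suc.prems that assms(1)]])
  moreover have "Ck_on k S (\<lambda>x. - (inverse (h x) * frechet_derivative h (at x) d * inverse (h x)))" for d
    by (intro Ck_on_linear[OF bounded_linear_minus[OF bounded_linear_ident] assms(1)]
        Ck_on_bilinear[OF bounded_bilinear_mult assms(1)] i Ck_on_open_directional[OF Suc.prems assms(1)])
  ultimately show ?case by (rule Ck_on_SucI[OF assms(1)])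
qed

text \<open>No induction: one differentiation replaces \<open>ln\<close> by a quotient, already
  covered by \<open>Ck_on_inverse\<close>.\<close>

lemma Ck_on_ln:
  fixes h :: "'a::euclidean_space \<Rightarrow> real"
  assumes "open S" "Ck_on k S h" and pos: "\<And>x. x \<in> S \<Longrightarrow> h x > 0"
  shows "Ck_on k S (\<lambda>x. ln (h x))"
proof (cases k)
  case 0
  then show ?thesis using assms(2) continuous_on_ln[of S h] pos by force
next
  case (Suc k')
  note h = assms(2)[unfolded Suc]
  have nz: "h x \<noteq> 0" if "x \<in> S" for x using pos[OF that] by linarith
  have "((\<lambda>x. ln (h x)) has_derivative (\<lambda>d. frechet_derivative h (at x) d * inverse (h x))) (at x)"
    if "x \<in> S" for x
    by (rule has_derivative_ln[OF pos[OF that] Ck_on_open_has_derivative[OF h that assms(1)]])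
  moreover have "Ck_on k' S (\<lambda>x. frechet_derivative h (at x) d * inverse (h x))" for d
    by (rule Ck_on_bilinear[OF bounded_bilinear_mult assms(1) Ck_on_open_directional[OF h assms(1)]
          Ck_on_inverse[OF assms(1) Ck_on_SucD[OF h] nz]])
  ultimately show ?thesis unfolding Suc by (rule Ck_on_SucI[OF assms(1)])
qed

section \<open>Closure properties of smooth functions\<close>

lemma smooth_on_cong: "(\<And>x. x \<in> S \<Longrightarrow> h x = h' x) \<Longrightarrow> smooth_on S h \<longleftrightarrow> smooth_on S h'"
  unfolding smooth_on_def using Ck_on_cong by blast

lemma smooth_on_continuous_on: "smooth_on S h \<Longrightarrow> continuous_on S h"
  unfolding smooth_on_def using Ck_on.simps(1) by blast

lemma smooth_on_has_derivative:
  "smooth_on S h \<Longrightarrow> x \<in> S \<Longrightarrow> (h has_derivative frechet_derivative h (at x within S)) (at x within S)"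
  unfolding smooth_on_def using Ck_on_has_derivative by blast

lemma smooth_on_directional:
  "smooth_on S h \<Longrightarrow> smooth_on S (\<lambda>x. frechet_derivative h (at x within S) d)"
  unfolding smooth_on_def using Ck_on.simps(2) by blast

lemma smooth_on_differentiable:
  "smooth_on S h \<Longrightarrow> open S \<Longrightarrow> x \<in> S \<Longrightarrow> h differentiable at x"
  unfolding smooth_on_def using Ck_on_open_has_derivative differentiableI by blast

lemma smooth_on_partial:
  assumes "smooth_on S h" "open S"
  shows "smooth_on S (partial i h)"
  using assms Ck_on_open_directional unfolding smooth_on_def partial_def by blast

lemma smooth_on_const: "open S \<Longrightarrow> smooth_on S (\<lambda>x. c)"
  unfolding smooth_on_def by (simp add: Ck_on_const)

lemma smooth_on_add:
  "open S \<Longrightarrow> smooth_on S h \<Longrightarrow> smooth_on S h' \<Longrightarrow> smooth_on S (\<lambda>x. h x + h' x)"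
  unfolding smooth_on_def by (simp add: Ck_on_add)

lemma smooth_on_bilinear:
  "bounded_bilinear B \<Longrightarrow> open S \<Longrightarrow> smooth_on S h \<Longrightarrow> smooth_on S h' \<Longrightarrow>
    smooth_on S (\<lambda>x. B (h x) (h' x))"
  unfolding smooth_on_def by (simp add: Ck_on_bilinear)

lemma smooth_on_linear:
  "bounded_linear L \<Longrightarrow> open S \<Longrightarrow> smooth_on S h \<Longrightarrow> smooth_on S (\<lambda>x. L (h x))"
  unfolding smooth_on_def by (simp add: Ck_on_linear)

lemma smooth_on_compose_affine:
  assumes "open S" "bounded_linear L" "\<And>x. x \<in> S \<Longrightarrow> c + L x \<in> T" "smooth_on T h"
  shows "smooth_on S (\<lambda>x. h (c + L x))"
  using assms(4) Ck_on_compose_affine[OF assms(1-3)] unfolding smooth_on_def by blast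

lemma smooth_on_inverse:
  fixes h :: "'a::euclidean_space \<Rightarrow> real"
  assumes "open S" "smooth_on S h" "\<And>x. x \<in> S \<Longrightarrow> h x \<noteq> 0"
  shows "smooth_on S (\<lambda>x. inverse (h x))"
  using assms unfolding smooth_on_def by (simp add: Ck_on_inverse)

lemma smooth_on_ln:
  fixes h :: "'a::euclidean_space \<Rightarrow> real"
  assumes "open S" "smooth_on S h" "\<And>x. x \<in> S \<Longrightarrow> h x > 0"
  shows "smooth_on S (\<lambda>x. ln (h x))"
  using assms unfolding smooth_on_def by (simp add: Ck_on_ln)

section \<open>Symmetry of mixed derivatives\<close>

text \<open>Two applications of the mean value theorem, first in direction \<open>i\<close> to the
  difference of two opposite edges, then in direction \<open>j\<close> to the first derivative.
  One-sided derivatives at the ends of \<open>{0..e}\<close> suffice, so \<open>x\<close> may be a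
  boundary point.\<close>

lemma second_difference_mvt:
  fixes h :: "'a::real_normed_vector \<Rightarrow> real"
  assumes "0 < e"
    and par: "\<And>s t. 0 \<le> s \<Longrightarrow> s \<le> e \<Longrightarrow> 0 \<le> t \<Longrightarrow> t \<le> e \<Longrightarrow> x + s *\<^sub>R i + t *\<^sub>R j \<in> S"
    and h': "\<And>y. y \<in> S \<Longrightarrow> (h has_derivative h' y) (at y within S)"
    and hi: "\<And>y. y \<in> S \<Longrightarrow> ((\<lambda>y. h' y i) has_derivative hi y) (at y within S)"
  obtains s t where "0 \<le> s" "s \<le> e" "0 \<le> t" "t \<le> e"
    "h (x + e *\<^sub>R i + e *\<^sub>R j) - h (x + e *\<^sub>R i) - h (x + e *\<^sub>R j) + h x
      = e * e * hi (x + s *\<^sub>R i + t *\<^sub>R j) j"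
proof -
  have chain: "((\<lambda>s. g (y + s *\<^sub>R d)) has_derivative (\<lambda>r. r * g' (y + s *\<^sub>R d) d)) (at s within {0..e})"
    if g: "\<And>y. y \<in> S \<Longrightarrow> (g has_derivative g' y) (at y within S)"
      and S: "\<And>s. 0 \<le> s \<Longrightarrow> s \<le> e \<Longrightarrow> y + s *\<^sub>R d \<in> S" and s: "0 \<le> s" "s \<le> e"
    for g :: "'a \<Rightarrow> real" and g' y d s
  proof -
    have "((\<lambda>s. y + s *\<^sub>R d) has_derivative (\<lambda>r. r *\<^sub>R d)) (at s within {0..e})"
      by (auto intro!: derivative_eq_intros)
    moreover have "(g has_derivative g' (y + s *\<^sub>R d)) (at (y + s *\<^sub>R d) within (\<lambda>s. y + s *\<^sub>R d) ` {0..e})"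
      by (rule has_derivative_subset[OF g[OF S[OF s]]]) (use S in auto)
    ultimately have "((\<lambda>s. g (y + s *\<^sub>R d)) has_derivative (\<lambda>r. g' (y + s *\<^sub>R d) (r *\<^sub>R d))) (at s within {0..e})"
      using has_derivative_in_compose by blast
    moreover have "linear (g' (y + s *\<^sub>R d))"
      using g[OF S[OF s]] has_derivative_linear by blast
    ultimately show ?thesis by (simp add: linear_scale)
  qed
  have e: "0 \<le> e" "e \<le> e" using assms(1) by auto
  have "((\<lambda>s. h (x + e *\<^sub>R j + s *\<^sub>R i) - h (x + s *\<^sub>R i)) has_derivative
      (\<lambda>r. r * h' (x + e *\<^sub>R j + s *\<^sub>R i) i - r * h' (x + s *\<^sub>R i) i)) (at s within {0..e})"
    if "0 \<le> s" "s \<le> e" for s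
    using par[OF _ _ e] par[of _ 0] that e
    by (intro has_derivative_diff chain[OF h']) (auto simp: ac_simps)
  from mvt_simple[OF \<open>0 < e\<close> this] obtain s where "s \<in> {0<..<e}"
    and s_eq': "h (x + e *\<^sub>R j + e *\<^sub>R i) - h (x + e *\<^sub>R i)
        - (h (x + e *\<^sub>R j + 0 *\<^sub>R i) - h (x + 0 *\<^sub>R i))
      = (e - 0) * h' (x + e *\<^sub>R j + s *\<^sub>R i) i - (e - 0) * h' (x + s *\<^sub>R i) i"
    by blast
  then have s: "0 \<le> s" "s \<le> e" by auto
  have s_eq: "h (x + e *\<^sub>R j + e *\<^sub>R i) - h (x + e *\<^sub>R i) - (h (x + e *\<^sub>R j) - h x)
      = e * (h' (x + e *\<^sub>R j + s *\<^sub>R i) i - h' (x + s *\<^sub>R i) i)"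
    using s_eq' by (simp add: right_diff_distrib)
  have "((\<lambda>t. h' (x + s *\<^sub>R i + t *\<^sub>R j) i) has_derivative
      (\<lambda>r. r * hi (x + s *\<^sub>R i + t *\<^sub>R j) j)) (at t within {0..e})" if "0 \<le> t" "t \<le> e" for t
    by (intro chain[OF hi]) (use par s that in auto)
  from mvt_simple[OF \<open>0 < e\<close> this] obtain t where "t \<in> {0<..<e}"
    and t_eq': "h' (x + s *\<^sub>R i + e *\<^sub>R j) i - h' (x + s *\<^sub>R i + 0 *\<^sub>R j) i
      = (e - 0) * hi (x + s *\<^sub>R i + t *\<^sub>R j) j"
    by blast
  then have t: "0 \<le> t" "t \<le> e" by auto
  have t_eq: "h' (x + s *\<^sub>R i + e *\<^sub>R j) i - h' (x + s *\<^sub>R i) i = e * hi (x + s *\<^sub>R i + t *\<^sub>R j) j"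
    using t_eq' by simp
  show ?thesis
  proof (rule that[OF s t])
    show "h (x + e *\<^sub>R i + e *\<^sub>R j) - h (x + e *\<^sub>R i) - h (x + e *\<^sub>R j) + h x
      = e * e * hi (x + s *\<^sub>R i + t *\<^sub>R j) j"
      using s_eq t_eq by (simp add: ac_simps)
  qed
qed

text \<open>The second difference is symmetric in \<open>i\<close> and \<open>j\<close>; evaluating
  it in both orders gives equal values of the two mixed derivatives at points near \<open>x\<close>,
  and continuity moves both to \<open>x\<close>.\<close>

lemma mixed_derivatives_commute_real:
  fixes h :: "'a::real_normed_vector \<Rightarrow> real"
  assumes par: "\<And>s t. 0 \<le> s \<Longrightarrow> s \<le> 1 \<Longrightarrow> 0 \<le> t \<Longrightarrow> t \<le> 1 \<Longrightarrow> x + s *\<^sub>R i + t *\<^sub>R j \<in> S"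
    and h': "\<And>y. y \<in> S \<Longrightarrow> (h has_derivative h' y) (at y within S)"
    and hi: "\<And>y. y \<in> S \<Longrightarrow> ((\<lambda>y. h' y i) has_derivative hi y) (at y within S)"
    and hj: "\<And>y. y \<in> S \<Longrightarrow> ((\<lambda>y. h' y j) has_derivative hj y) (at y within S)"
    and cont: "continuous_on S (\<lambda>y. hi y j)" "continuous_on S (\<lambda>y. hj y i)"
  shows "hi x j = hj x i"
proof -
  have x: "x \<in> S" using par[of 0 0] by simp
  have "\<bar>hi x j - hj x i\<bar> \<le> 2 * \<epsilon>" if eps: "0 < \<epsilon>" for \<epsilon>
  proof -
    obtain d1 where d1: "0 < d1" "\<And>y. y \<in> S \<Longrightarrow> dist y x < d1 \<Longrightarrow> dist (hi y j) (hi x j) < \<epsilon>"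
      using cont(1) x eps unfolding continuous_on_iff by blast
    obtain d2 where d2: "0 < d2" "\<And>y. y \<in> S \<Longrightarrow> dist y x < d2 \<Longrightarrow> dist (hj y i) (hj x i) < \<epsilon>"
      using cont(2) x eps unfolding continuous_on_iff by blast
    define m where "m = norm i + norm j + 1"
    have m: "0 < m" unfolding m_def by (smt (verit) norm_ge_zero)
    \<comment> \<open>The summand 1 in \<open>m\<close> keeps the denominator positive, and the
      factor 2 makes \<open>e * m\<close> strictly smaller than \<open>d1\<close> and
      \<open>d2\<close>.\<close>
    define e where "e = min 1 (min d1 d2 / (2 * m))"
    have e: "0 < e" "e \<le> 1" using m d1(1) d2(1) by (auto simp: e_def)
    have "e \<le> min d1 d2 / (2 * m)" by (simp add: e_def)
    then have "2 * (e * m) \<le> min d1 d2" using m by (simp add: field_simps)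
    moreover have "0 < e * m" using e m by simp
    ultimately have em: "e * m < d1" "e * m < d2" by auto
    have near: "dist (x + s *\<^sub>R i + t *\<^sub>R j) x \<le> e * m" if "0 \<le> s" "s \<le> e" "0 \<le> t" "t \<le> e" for s t
    proof -
      have "dist (x + s *\<^sub>R i + t *\<^sub>R j) x = norm (s *\<^sub>R i + t *\<^sub>R j)" by (simp add: dist_norm algebra_simps)
      also have "\<dots> \<le> s * norm i + t * norm j"
        using norm_triangle_ineq[of "s *\<^sub>R i" "t *\<^sub>R j"] that by simp
      also have "\<dots> \<le> e * norm i + e * norm j"
        using that by (intro add_mono mult_right_mono) auto
      also have "\<dots> \<le> e * m" using e by (simp add: m_def algebra_simps)
      finally show ?thesis .
    qed
    have par': "x + s *\<^sub>R i + t *\<^sub>R j \<in> S" if "0 \<le> s" "s \<le> e" "0 \<le> t" "t \<le> e" for s t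
      using par that e(2) by simp
    have par'': "x + s *\<^sub>R j + t *\<^sub>R i \<in> S" if "0 \<le> s" "s \<le> e" "0 \<le> t" "t \<le> e" for s t
      using par'[OF that(3,4,1,2)] by (simp add: add.commute add.left_commute)
    obtain s t where st: "0 \<le> s" "s \<le> e" "0 \<le> t" "t \<le> e"
      and st_eq: "h (x + e *\<^sub>R i + e *\<^sub>R j) - h (x + e *\<^sub>R i) - h (x + e *\<^sub>R j) + h x
      = e * e * hi (x + s *\<^sub>R i + t *\<^sub>R j) j"
      by (rule second_difference_mvt[OF e(1) par' h' hi])
    obtain t' s' where st': "0 \<le> t'" "t' \<le> e" "0 \<le> s'" "s' \<le> e"
      and st'_eq: "h (x + e *\<^sub>R j + e *\<^sub>R i) - h (x + e *\<^sub>R j) - h (x + e *\<^sub>R i) + h x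
      = e * e * hj (x + t' *\<^sub>R j + s' *\<^sub>R i) i"
      by (rule second_difference_mvt[OF e(1) par'' h' hj])
    have "e * e * hi (x + s *\<^sub>R i + t *\<^sub>R j) j = e * e * hj (x + t' *\<^sub>R j + s' *\<^sub>R i) i"
      using st_eq st'_eq[unfolded add.assoc[of x "e *\<^sub>R j"] add.commute[of "e *\<^sub>R j"] add.assoc[of x, symmetric]]
      by linarith
    then have eq: "hi (x + s *\<^sub>R i + t *\<^sub>R j) j = hj (x + s' *\<^sub>R i + t' *\<^sub>R j) i"
      using e(1) by (simp add: ac_simps)
    have "dist (hi (x + s *\<^sub>R i + t *\<^sub>R j) j) (hi x j) < \<epsilon>"
      using st e near[OF st] em by (intro d1(2) par) auto
    moreover have "dist (hj (x + s' *\<^sub>R i + t' *\<^sub>R j) i) (hj x i) < \<epsilon>"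
      using st' e near[OF st'(3,4,1,2)] em by (intro d2(2) par) auto
    ultimately show ?thesis unfolding eq dist_real_def by linarith
  qed
  then have "\<bar>hi x j - hj x i\<bar> \<le> 0 + \<epsilon>" if "0 < \<epsilon>" for \<epsilon>
    using that[THEN half_gt_zero] by fastforce
  then have "\<bar>hi x j - hj x i\<bar> \<le> 0" using field_le_epsilon by blast
  then show ?thesis by simp
qed

text \<open>
  The factors \<open>c\<close> and \<open>d\<close> may be negative, so that the parallelogram can be chosen inside \<open>S\<close> even
  when \<open>x\<close> is a boundary point of \<open>S\<close>.
\<close>

lemma mixed_derivatives_commute:
  fixes h :: "'a::real_normed_vector \<Rightarrow> 'b::euclidean_space"
  assumes par: "\<And>s t. 0 \<le> s \<Longrightarrow> s \<le> 1 \<Longrightarrow> 0 \<le> t \<Longrightarrow> t \<le> 1 \<Longrightarrow>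
      x + (s * c) *\<^sub>R i + (t * d) *\<^sub>R j \<in> S"
    and cd: "c \<noteq> 0" "d \<noteq> 0"
    and h': "\<And>y. y \<in> S \<Longrightarrow> (h has_derivative h' y) (at y within S)"
    and hi: "\<And>y. y \<in> S \<Longrightarrow> ((\<lambda>y. h' y i) has_derivative hi y) (at y within S)"
    and hj: "\<And>y. y \<in> S \<Longrightarrow> ((\<lambda>y. h' y j) has_derivative hj y) (at y within S)"
    and cont: "continuous_on S (\<lambda>y. hi y j)" "continuous_on S (\<lambda>y. hj y i)"
  shows "hi x j = hj x i"
proof (rule euclidean_eqI)
  fix b :: 'b assume "b \<in> Basis"
  have x: "x \<in> S" using par[of 0 0] by simp
  have scale: "((\<lambda>y. h' y (r *\<^sub>R k) \<bullet> b) has_derivative (\<lambda>z. r * (hk y z \<bullet> b))) (at y within S)"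
    if "y \<in> S" and k: "((\<lambda>y. h' y k) has_derivative hk y) (at y within S)" for y r k hk
  proof (rule has_derivative_transform[OF that(1)])
    show "h' y (r *\<^sub>R k) \<bullet> b = r * (h' y k \<bullet> b)" if "y \<in> S" for y
      using has_derivative_linear[OF h'[OF that]] by (simp add: linear_scale)
    show "((\<lambda>y. r * (h' y k \<bullet> b)) has_derivative (\<lambda>z. r * (hk y z \<bullet> b))) (at y within S)"
      by (intro has_derivative_mult_right has_derivative_inner_left k)
  qed
  have lin: "hi x (d *\<^sub>R j) = d *\<^sub>R hi x j" "hj x (c *\<^sub>R i) = c *\<^sub>R hj x i"
    using has_derivative_linear[OF hi[OF x]] has_derivative_linear[OF hj[OF x]] by (simp_all add: linear_scale)
  \<comment> \<open>The real-valued lemma is applied to one component and to the rescaled directions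
    \<open>c *\<^sub>R i\<close> and \<open>d *\<^sub>R j\<close>. By linearity both sides carry the
    factor \<open>c * d\<close>, which is cancelled at the end.\<close>
  have "(\<lambda>y z. c * (hi y z \<bullet> b)) x (d *\<^sub>R j) = (\<lambda>y z. d * (hj y z \<bullet> b)) x (c *\<^sub>R i)"
  proof (rule mixed_derivatives_commute_real[where h="\<lambda>y. h y \<bullet> b" and h'="\<lambda>y z. h' y z \<bullet> b"])
    show "((\<lambda>y. h y \<bullet> b) has_derivative (\<lambda>z. h' y z \<bullet> b)) (at y within S)" if "y \<in> S" for y
      by (intro has_derivative_inner_left h' that)
    have "continuous_on S (\<lambda>y. c * (d * (hi y j \<bullet> b)))" "continuous_on S (\<lambda>y. d * (c * (hj y i \<bullet> b)))"
      by (intro continuous_intros cont)+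
    moreover have "c * (d * (hi y j \<bullet> b)) = c * (hi y (d *\<^sub>R j) \<bullet> b)"
        "d * (c * (hj y i \<bullet> b)) = d * (hj y (c *\<^sub>R i) \<bullet> b)" if "y \<in> S" for y
      using has_derivative_linear[OF hi[OF that]] has_derivative_linear[OF hj[OF that]]
      by (simp_all add: linear_scale)
    ultimately show "continuous_on S (\<lambda>y. c * (hi y (d *\<^sub>R j) \<bullet> b))"
        "continuous_on S (\<lambda>y. d * (hj y (c *\<^sub>R i) \<bullet> b))"
      by (simp_all cong: continuous_on_cong)
  qed (use par scale hi hj in simp_all)
  then show "hi x j \<bullet> b = hj x i \<bullet> b" using cd by (simp add: lin)
qed

lemma partial_commute:
  fixes h :: "real^2 \<Rightarrow> 'b::euclidean_space"
  assumes "smooth_on S h" "open S" "p \<in> S"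
  shows "partial i (partial j h) p = partial j (partial i h) p"
proof -
  obtain r where r: "0 < r" "ball p r \<subseteq> S" using assms(2,3) open_contains_ball by blast
  note sm = assms(1) smooth_on_partial[OF assms(1,2)]
  have D: "(g has_derivative frechet_derivative g (at y)) (at y within S)"
    if "smooth_on S g" "y \<in> S" for y and g :: "real^2 \<Rightarrow> 'b"
    using smooth_on_has_derivative[OF that] at_within_open[OF that(2) assms(2)] by simp
  have C: "continuous_on S (partial i (partial j h))" for i j
    by (intro smooth_on_continuous_on smooth_on_partial assms(1,2))
  show ?thesis unfolding partial_def
  \<comment> \<open>Two edges of length \<open>r/3\<close> reach at most
    \<open>2 * r / 3 < r\<close> from \<open>p\<close>, so the parallelogram stays in the
    ball.\<close>
  proof (rule mixed_derivatives_commute[where c="r/3" and d="r/3" and S=S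
        and hi="\<lambda>y. frechet_derivative (\<lambda>q. frechet_derivative h (at q) (axis j 1)) (at y)"
        and hj="\<lambda>y. frechet_derivative (\<lambda>q. frechet_derivative h (at q) (axis i 1)) (at y)"
        and h'="\<lambda>y. frechet_derivative h (at y)" and h=h])
    fix s t :: real assume "0 \<le> s" "s \<le> 1" "0 \<le> t" "t \<le> 1"
    then have "norm ((s * (r / 3)) *\<^sub>R axis j 1 + (t * (r / 3)) *\<^sub>R axis i 1 :: real^2) \<le> s * (r/3) + t * (r/3)"
      using r norm_triangle_ineq[of "(s * (r / 3)) *\<^sub>R axis j 1 :: real^2" "(t * (r / 3)) *\<^sub>R axis i 1"] by simp
    also have "\<dots> \<le> 1 * (r/3) + 1 * (r/3)"
      using r \<open>s \<le> 1\<close> \<open>t \<le> 1\<close> by (intro add_mono mult_right_mono) auto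
    also have "\<dots> < r" using r by simp
    finally have "dist p (p + ((s * (r / 3)) *\<^sub>R axis j 1 + (t * (r / 3)) *\<^sub>R axis i 1)) < r"
      by (simp only: dist_norm norm_minus_commute[of p] add_diff_cancel_left')
    then have "p + (s * (r / 3)) *\<^sub>R axis j 1 + (t * (r / 3)) *\<^sub>R axis i 1 \<in> ball p r"
      by (simp add: add.assoc)
    then show "p + (s * (r / 3)) *\<^sub>R axis j 1 + (t * (r / 3)) *\<^sub>R axis i 1 \<in> S" using r(2) by blast
  qed (use r D[OF assms(1)] D[OF sm(2)] C in \<open>auto simp: partial_def[abs_def]\<close>)
qed

section \<open>Families of functions depending on a parameter\<close>

text \<open>Passes from joint smoothness on \<open>J \<times> D\<close> to what the Sym formula
  uses: smooth slices, and the exchange of the parameter derivative with \<open>partial i\<close>.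
  An interval with nonempty interior has no isolated points, so derivatives within \<open>J\<close>
  are unique even at end points.\<close>

lemma smooth_on_slice_derivatives:
  fixes \<Phi> :: "real \<Rightarrow> real^2 \<Rightarrow> 'b::euclidean_space"
  assumes J: "is_interval J" "interior J \<noteq> {}" and D: "open D"
    and sm: "smooth_on (J \<times> D) (\<lambda>(\<tau>, p). \<Phi> \<tau> p)" and \<tau>: "\<tau> \<in> J"
  defines "X \<equiv> \<lambda>p. vector_derivative (\<lambda>t. \<Phi> t p) (at \<tau> within J)"
  shows "at \<tau> within J \<noteq> bot"
    and "smooth_on D (\<Phi> \<tau>)" and "smooth_on D X"
    and "p \<in> D \<Longrightarrow> ((\<lambda>t. \<Phi> t p) has_vector_derivative X p) (at \<tau> within J)"
    and "p \<in> D \<Longrightarrow> ((\<lambda>t. partial i (\<Phi> t) p) has_vector_derivative partial i X p) (at \<tau> within J)"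
proof -
  let ?S = "J \<times> D"
  define h where "h = (\<lambda>(\<tau>, p). \<Phi> \<tau> p)"
  note smh = sm[folded h_def]
  have h: "h (t, q) = \<Phi> t q" for t q by (simp add: h_def)
  have "J \<noteq> {\<tau>}" using J(2) by auto
  then have "\<tau> islimpt J"
    using connected_imp_perfect \<tau> J(1) is_interval_connected by blast
  then show nb: "at \<tau> within J \<noteq> bot"
    by (simp add: trivial_limit_within)
  have slice: "smooth_on D (\<lambda>q. g (t, q))" if "smooth_on ?S g" "t \<in> J" for g :: "real \<times> (real^2) \<Rightarrow> 'b" and t
  proof -
    have "bounded_linear (\<lambda>q. (0, q))" by (intro bounded_linear_Pair bounded_linear_zero bounded_linear_ident)
    from smooth_on_compose_affine[OF D this, of "(t, 0)" ?S g] show ?thesis using that by simp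
  qed
  have part: "partial k (\<lambda>q. g (t, q)) q = frechet_derivative g (at (t, q) within ?S) (0, axis k 1)"
    if g: "smooth_on ?S g" and "t \<in> J" "q \<in> D" for g :: "real \<times> (real^2) \<Rightarrow> 'b" and k t q
  proof -
    have 1: "((\<lambda>q. (t, q)) has_derivative (\<lambda>d. (0, d))) (at q within D)"
      by (auto intro!: derivative_eq_intros)
    have 2: "(g has_derivative frechet_derivative g (at (t, q) within ?S)) (at (t, q) within (\<lambda>q. (t, q)) ` D)"
      by (rule has_derivative_subset[OF smooth_on_has_derivative[OF g]]) (use that in auto)
    have "((\<lambda>q. g (t, q)) has_derivative (\<lambda>d. frechet_derivative g (at (t, q) within ?S) (0, d))) (at q)"
      using has_derivative_in_compose[OF 1 2] at_within_open[OF \<open>q \<in> D\<close> D] by simp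
    then show ?thesis unfolding partial_def using frechet_derivative_at by metis
  qed
  have vec: "((\<lambda>t. g (t, q)) has_vector_derivative frechet_derivative g (at (t, q) within ?S) (1, 0)) (at t within J)"
    if g: "smooth_on ?S g" and "t \<in> J" "q \<in> D" for g :: "real \<times> (real^2) \<Rightarrow> 'b" and t q
  proof -
    let ?A = "frechet_derivative g (at (t, q) within ?S)"
    have 1: "((\<lambda>t. (t, q)) has_derivative (\<lambda>d. (d, 0))) (at t within J)"
      by (auto intro!: derivative_eq_intros)
    have g': "(g has_derivative ?A) (at (t, q) within ?S)"
      by (rule smooth_on_has_derivative[OF g]) (use that in auto)
    have 2: "(g has_derivative ?A) (at (t, q) within (\<lambda>t. (t, q)) ` J)"
      by (rule has_derivative_subset[OF g']) (use that in auto)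
    have "(\<lambda>r. ?A (r, 0)) = (\<lambda>r. r *\<^sub>R ?A (1, 0))"
    proof
      show "?A (r, 0) = r *\<^sub>R ?A (1, 0)" for r
        using linear_scale[OF has_derivative_linear[OF g'], of r "(1, 0)"] by simp
    qed
    then show ?thesis
      using has_derivative_in_compose[OF 1 2] unfolding has_vector_derivative_def by (simp only:)
  qed
  have Xh: "X q = frechet_derivative h (at (\<tau>, q) within ?S) (1, 0)" if "q \<in> D" for q
    unfolding X_def using vector_derivative_within[OF nb vec[OF smh \<tau> that]] by (simp add: h)
  show "smooth_on D (\<Phi> \<tau>)" using slice[OF smh \<tau>] by (simp add: h)
  show "smooth_on D X"
    by (rule iffD2[OF smooth_on_cong[OF Xh] slice[OF smooth_on_directional[OF smh] \<tau>]])
  show "((\<lambda>t. \<Phi> t p) has_vector_derivative X p) (at \<tau> within J)" if "p \<in> D"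
    using vec[OF smh \<tau> that] by (simp add: h Xh[OF that])
  show "((\<lambda>t. partial i (\<Phi> t) p) has_vector_derivative partial i X p) (at \<tau> within J)" if p: "p \<in> D"
  proof -
    let ?hu = "\<lambda>y. frechet_derivative h (at y within ?S) (0, axis i 1)"
    let ?ht = "\<lambda>y. frechet_derivative h (at y within ?S) (1, 0)"
    have "partial i (\<Phi> t) p = ?hu (t, p)" if "t \<in> J" for t
      using part[OF smh that p] by (simp add: h)
    then have 1: "((\<lambda>t. partial i (\<Phi> t) p) has_vector_derivative
        frechet_derivative ?hu (at (\<tau>, p) within ?S) (1, 0)) (at \<tau> within J)"
      by (rule has_vector_derivative_transform[OF \<tau> _ vec[OF smooth_on_directional[OF smh] \<tau> p]])
    have "partial i X p = partial i (\<lambda>q. ?ht (\<tau>, q)) p"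
      unfolding partial_def
      using frechet_derivative_within_cong[of p D X "\<lambda>q. ?ht (\<tau>, q)"] Xh p at_within_open[OF p D] by simp
    also have "\<dots> = frechet_derivative ?ht (at (\<tau>, p) within ?S) (0, axis i 1)"
      by (rule part[OF smooth_on_directional[OF smh] \<tau> p])
    also have "\<dots> = frechet_derivative ?hu (at (\<tau>, p) within ?S) (1, 0)"
    proof -
      \<comment> \<open>The parallelogram leans from \<tau> towards a second point \<open>a\<close>
        of \<open>J\<close>, so convexity keeps it inside; \<open>a - \<tau>\<close> is negative if
        \<tau> is a right end point.\<close>
      obtain a where a: "a \<in> J" "a \<noteq> \<tau>" using \<open>J \<noteq> {\<tau>}\<close> \<tau> by blast
      obtain r where r: "0 < r" "ball p r \<subseteq> D" using D p open_contains_ball by blast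
      show ?thesis
      proof (rule mixed_derivatives_commute[where c="a - \<tau>" and d="r/2" and S="?S" and h=h
            and h'="\<lambda>y. frechet_derivative h (at y within ?S)"
            and hi="\<lambda>y. frechet_derivative ?ht (at y within ?S)"
            and hj="\<lambda>y. frechet_derivative ?hu (at y within ?S)"])
        fix s t :: real assume st: "0 \<le> s" "s \<le> 1" "0 \<le> t" "t \<le> 1"
        have "\<tau> + s * (a - \<tau>) = (1 - s) *\<^sub>R \<tau> + s *\<^sub>R a" by (simp add: algebra_simps)
        then have "\<tau> + s * (a - \<tau>) \<in> J"
          using is_interval_convex[OF J(1)] a(1) \<tau> st convexD_alt[of J \<tau> a s] by simp
        moreover have "norm ((t * (r/2)) *\<^sub>R axis i (1::real)) \<le> 1 * (r/2)"
          using st r by (simp add: mult_right_mono)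
        then have "p + (t * (r/2)) *\<^sub>R axis i 1 \<in> ball p r" using r by (simp add: dist_norm)
        ultimately show "(\<tau>, p) + (s * (a - \<tau>)) *\<^sub>R (1, 0) + (t * (r / 2)) *\<^sub>R (0, axis i 1) \<in> ?S"
          using r(2) by auto
      next
        show "continuous_on ?S (\<lambda>y. frechet_derivative ?ht (at y within ?S) (0, axis i 1))"
          "continuous_on ?S (\<lambda>y. frechet_derivative ?hu (at y within ?S) (1, 0))"
          by (intro smooth_on_continuous_on smooth_on_directional smh)+
      qed (use a r in \<open>auto intro: smooth_on_has_derivative smooth_on_directional smh\<close>)
    qed
    finally show ?thesis using 1 by simp
  qed
qed

section \<open>Calculus of matrix-valued functions of two variables\<close>

lemma partial_eq:
  "(h has_derivative h') (at p) \<Longrightarrow> partial i h p = h' (axis i 1)"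
  unfolding partial_def using frechet_derivative_at by metis

lemma partial_cong:
  assumes "open S" "p \<in> S" "\<And>q. q \<in> S \<Longrightarrow> h q = h' q"
  shows "partial i h p = partial i h' p"
  unfolding partial_def
  using frechet_derivative_within_cong[of p S h h'] assms at_within_open[OF assms(2,1)] by simp

lemma partial_const [simp]: "partial i (\<lambda>q. c) p = 0"
  by (simp add: partial_def)

lemma partial_bilinear:
  assumes "bounded_bilinear B" "h differentiable at p" "g differentiable at p"
  shows "partial i (\<lambda>q. B (h q) (g q)) p = B (h p) (partial i g p) + B (partial i h p) (g p)"
  using partial_eq[OF bounded_bilinear.FDERIV[OF assms(1) assms(2,3)[unfolded frechet_derivative_works]]]
  unfolding partial_def by simp

lemma partial_linear:
  assumes "bounded_linear L" "h differentiable at p"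
  shows "partial i (\<lambda>q. L (h q)) p = L (partial i h p)"
  using partial_eq[OF bounded_linear.has_derivative[OF assms(1) assms(2)[unfolded frechet_derivative_works]]]
  unfolding partial_def by simp

lemma partial_add:
  assumes "h differentiable at p" "g differentiable at p"
  shows "partial i (\<lambda>q. h q + g q) p = partial i h p + partial i g p"
  using partial_eq[OF has_derivative_add[OF assms[unfolded frechet_derivative_works]]]
  unfolding partial_def by simp

lemma partial_exp:
  fixes h :: "real^2 \<Rightarrow> real"
  assumes "h differentiable at p"
  shows "partial i (\<lambda>q. exp (c * h q)) p = c * partial i h p * exp (c * h p)"
  using partial_eq[OF has_derivative_exp[OF has_derivative_mult_right[OF assms[unfolded frechet_derivative_works]]]]
  unfolding partial_def by simp

lemma frechet_derivative_eq_partials: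
  assumes "h differentiable at p"
  shows "frechet_derivative h (at p) x = (x $ 1) *\<^sub>R partial 1 h p + (x $ 2) *\<^sub>R partial 2 h p"
proof -
  have x: "x = (x $ 1) *\<^sub>R axis 1 1 + (x $ 2) *\<^sub>R axis 2 1"
    by (simp add: vec_eq_iff forall_2 axis_def)
  have "linear (frechet_derivative h (at p))" using assms by (rule linear_frechet_derivative)
  then have "frechet_derivative h (at p) ((x $ 1) *\<^sub>R axis 1 1 + (x $ 2) *\<^sub>R axis 2 1)
      = (x $ 1) *\<^sub>R partial 1 h p + (x $ 2) *\<^sub>R partial 2 h p"
    unfolding partial_def by (simp add: linear_add linear_scale)
  then show ?thesis using x by simp
qed

section \<open>Algebra of real 2 by 2 matrices, the Minkowski product and conjugation\<close>

lemma mat2_nth [simp]: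
  "mat2 a b c d $ 1 $ 1 = a" "mat2 a b c d $ 1 $ 2 = b" "mat2 a b c d $ 2 $ 1 = c" "mat2 a b c d $ 2 $ 2 = d"
  by (simp_all add: mat2_def)

lemma mat2_eqI:
  fixes A B :: "real^2^2"
  shows "A $ 1 $ 1 = B $ 1 $ 1 \<Longrightarrow> A $ 1 $ 2 = B $ 1 $ 2 \<Longrightarrow> A $ 2 $ 1 = B $ 2 $ 1 \<Longrightarrow> A $ 2 $ 2 = B $ 2 $ 2 \<Longrightarrow> A = B"
  by (simp add: vec_eq_iff forall_2)

lemma mat2_mult_nth: "(A ** B) $ i $ j = A $ i $ 1 * B $ 1 $ j + A $ i $ 2 * B $ 2 $ (j::2)" for A B :: "real^2^2"
  by (simp add: matrix_matrix_mult_def sum_2)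

lemma trace_2: "trace A = A $ 1 $ 1 + A $ 2 $ 2" for A :: "real^2^2"
  by (simp add: trace_def sum_2)

lemma mink_eq: "mink X Y = (X $ 1 $ 1 * Y $ 1 $ 1 + X $ 1 $ 2 * Y $ 2 $ 1 + X $ 2 $ 1 * Y $ 1 $ 2 + X $ 2 $ 2 * Y $ 2 $ 2) / 2"
  by (simp add: mink_def trace_2 mat2_mult_nth)

lemma mink_commute: "mink X Y = mink Y X"
  by (simp add: mink_eq)

lemma mink_linear [simp]:
  "mink (X + Y) Z = mink X Z + mink Y Z" "mink X (Y + Z) = mink X Y + mink X Z"
  "mink (r *\<^sub>R X) Z = r * mink X Z" "mink X (r *\<^sub>R Z) = r * mink X Z"
  "mink (- X) Z = - mink X Z" "mink X (- Z) = - mink X Z"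
  "mink (X - Y) Z = mink X Z - mink Y Z" "mink X (Y - Z) = mink X Y - mink X Z"
  by (simp_all add: mink_eq algebra_simps add_divide_distrib diff_divide_distrib)

lemma bounded_bilinear_mink: "bounded_bilinear mink"
  unfolding bilinear_conv_bounded_bilinear[symmetric] bilinear_def
  by (auto intro!: linearI)

lemma bounded_bilinear_matrix_mult: "bounded_bilinear (\<lambda>(A::real^2^2) (B::real^2^2). A ** B)"
  unfolding bilinear_conv_bounded_bilinear[symmetric] bilinear_def
  by (auto intro!: linearI mat2_eqI simp: mat2_mult_nth algebra_simps)

text \<open>The adjugate. It is the inverse for determinant 1, and unlike \<open>matrix_inv\<close>
  it is linear in the entries, hence differentiates and preserves smoothness directly.\<close>

definition adj2 :: "real^2^2 \<Rightarrow> real^2^2" where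
  "adj2 A = mat2 (A $ 2 $ 2) (- A $ 1 $ 2) (- A $ 2 $ 1) (A $ 1 $ 1)"

lemma adj2_nth [simp]:
  "adj2 A $ 1 $ 1 = A $ 2 $ 2" "adj2 A $ 1 $ 2 = - A $ 1 $ 2"
  "adj2 A $ 2 $ 1 = - A $ 2 $ 1" "adj2 A $ 2 $ 2 = A $ 1 $ 1"
  by (simp_all add: adj2_def)

lemma bounded_linear_adj2: "bounded_linear adj2"
  unfolding linear_conv_bounded_linear[symmetric]
  by (auto intro!: linearI mat2_eqI)

lemma adj2_mult: "adj2 (A ** B) = adj2 B ** adj2 A"
  by (auto intro!: mat2_eqI simp: mat2_mult_nth)

lemma adj2_sl2: "X \<in> sl2 \<Longrightarrow> adj2 X = - X"
  by (auto intro!: mat2_eqI simp: sl2_def trace_2)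

lemma adj2_inverse: "det A = 1 \<Longrightarrow> A ** adj2 A = mat 1" "det A = 1 \<Longrightarrow> adj2 A ** A = mat 1"
  by (auto intro!: mat2_eqI simp: mat2_mult_nth det_2 mat_def algebra_simps)

lemma matrix_inv_eq_adj2:
  assumes "det A = 1"
  shows "matrix_inv A = adj2 A"
proof -
  have "A ** matrix_inv A = mat 1"
    unfolding matrix_inv_def using adj2_inverse[OF assms] by (metis (mono_tags, lifting) someI_ex)
  then have "adj2 A ** (A ** matrix_inv A) = adj2 A ** mat 1" by simp
  then show ?thesis by (simp add: matrix_mul_assoc adj2_inverse[OF assms])
qed

text \<open>Cyclicity of the trace; this is the invariance of the scalar product under
  \<open>Ad\<close>.\<close>

lemma mink_conj:
  assumes "det P = 1"
  shows "mink (P ** X ** adj2 P) (P ** Y ** adj2 P) = mink X Y"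
proof -
  have "(P ** X ** adj2 P) ** (P ** Y ** adj2 P) = P ** (X ** (adj2 P ** P) ** Y ** adj2 P)"
    by (simp add: matrix_mul_assoc)
  then have "trace ((P ** X ** adj2 P) ** (P ** Y ** adj2 P)) = trace ((X ** Y ** adj2 P) ** P)"
    by (subst trace_mul_sym) (simp add: adj2_inverse[OF assms])
  then show ?thesis
    by (simp add: mink_def matrix_mul_assoc[symmetric] adj2_inverse[OF assms])
qed

text \<open>The trace is twice \<open>mink\<close> against the identity, which conjugation fixes, so
  this is an instance of \<open>mink_conj\<close>.\<close>

lemma conj_in_sl2: "det P = 1 \<Longrightarrow> X \<in> sl2 \<Longrightarrow> P ** X ** adj2 P \<in> sl2"
  using mink_conj[of P X "mat 1"]
  by (simp add: sl2_def mink_def adj2_inverse)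

lemma matrix_mult_linear [simp]:
  fixes A B C :: "real^2^2"
  shows "(A - B) ** C = A ** C - B ** C" "C ** (A - B) = C ** A - C ** B"
    "(- A) ** C = - (A ** C)" "C ** (- A) = - (C ** A)"
    "(r *\<^sub>R A) ** C = r *\<^sub>R (A ** C)" "C ** (r *\<^sub>R A) = r *\<^sub>R (C ** A)"
  by (auto intro!: mat2_eqI simp: mat2_mult_nth algebra_simps)

lemma partial_mat2:
  assumes "a differentiable at p" "b differentiable at p" "c differentiable at p" "d differentiable at p"
  shows "partial i (\<lambda>q. mat2 (a q) (b q) (c q) (d q)) p
    = mat2 (partial i a p) (partial i b p) (partial i c p) (partial i d p)"
proof -
  have m: "mat2 x y z w = x *\<^sub>R mat2 1 0 0 0 + y *\<^sub>R mat2 0 1 0 0 + z *\<^sub>R mat2 0 0 1 0 + w *\<^sub>R mat2 0 0 0 1"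
    for x y z w by (auto intro!: mat2_eqI)
  have fun_eq: "(\<lambda>q. mat2 (a q) (b q) (c q) (d q))
      = (\<lambda>q. a q *\<^sub>R mat2 1 0 0 0 + b q *\<^sub>R mat2 0 1 0 0 + c q *\<^sub>R mat2 0 0 1 0 + d q *\<^sub>R mat2 0 0 0 1)"
    by (rule ext) (rule m)
  have "((\<lambda>q. mat2 (a q) (b q) (c q) (d q)) has_derivative
      (\<lambda>x. frechet_derivative a (at p) x *\<^sub>R mat2 1 0 0 0 + frechet_derivative b (at p) x *\<^sub>R mat2 0 1 0 0
        + frechet_derivative c (at p) x *\<^sub>R mat2 0 0 1 0 + frechet_derivative d (at p) x *\<^sub>R mat2 0 0 0 1)) (at p)"
    unfolding fun_eq
    by (intro has_derivative_add has_derivative_scaleR_left assms[unfolded frechet_derivative_works])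
  from partial_eq[OF this] show ?thesis
    unfolding partial_def by (rule trans) (rule m[symmetric])
qed

lemma sl2_iff: "X \<in> sl2 \<longleftrightarrow> X $ 2 $ 2 = - X $ 1 $ 1"
  by (auto simp: sl2_def trace_2)

lemma smooth_on_coordinate:
  fixes D :: "(real^2) set"
  assumes "open D" "smooth_on ((\<lambda>p. p $ i) ` D) \<phi>"
  shows "smooth_on D (\<lambda>p. \<phi> (p $ i))"
  using smooth_on_compose_affine[OF assms(1) bounded_linear_vec_nth[of i], of 0 "(\<lambda>p. p $ i) ` D" \<phi>] assms(2)
  by simp

text \<open>\<open>f\<close> and \<open>g\<close> are controlled only on the projections of
  \<open>D\<close>, hence the within-derivative there; composing with the projection and using
  openness of \<open>D\<close> gives a full derivative.\<close>

lemma partial_coordinate: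
  assumes "open D" "p \<in> D" "\<phi> differentiable (at (p $ i) within (\<lambda>p. p $ i) ` D)" "j \<noteq> i"
  shows "partial j (\<lambda>p. \<phi> (p $ i)) p = 0" "(\<lambda>p. \<phi> (p $ i)) differentiable at p"
proof -
  obtain \<phi>' where \<phi>': "(\<phi> has_derivative \<phi>') (at (p $ i) within (\<lambda>p. p $ i) ` D)"
    using assms(3) by (auto simp: differentiable_def)
  have "((\<lambda>p. p $ i) has_derivative (\<lambda>d. d $ i)) (at p within D)"
    by (rule bounded_linear_imp_has_derivative[OF bounded_linear_vec_nth])
  from has_derivative_in_compose[OF this \<phi>']
  have *: "((\<lambda>p. \<phi> (p $ i)) has_derivative (\<lambda>d. \<phi>' (d $ i))) (at p)"
    using at_within_open[OF assms(2,1)] by simp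
  have "\<phi>' 0 = 0" using has_derivative_linear[OF \<phi>'] by (rule linear_0)
  with partial_eq[OF *, of j] assms(4) show "partial j (\<lambda>p. \<phi> (p $ i)) p = 0"
    by (simp add: axis_def)
  show "(\<lambda>p. \<phi> (p $ i)) differentiable at p" using * by (rule differentiableI)
qed

text \<open>For trace-free \<open>W\<close> the adjugate of \<open>P ** W\<close> is
  \<open>- W ** adj2 P\<close>, so differentiating the two outer factors yields the commutator of
  \<open>W\<close> and \<open>E\<close>.\<close>

lemma partial_conj:
  assumes P: "P differentiable at p" "partial i P p = P p ** W" and W: "W \<in> sl2"
    and r: "r differentiable at p"
  shows "partial i (\<lambda>q. r q *\<^sub>R (P q ** E ** adj2 (P q))) p
    = r p *\<^sub>R (P p ** (W ** E - E ** W) ** adj2 (P p)) + partial i r p *\<^sub>R (P p ** E ** adj2 (P p))"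
proof -
  have adj: "bounded_linear (\<lambda>X. E ** adj2 X)"
    by (rule bounded_linear_compose[OF bounded_bilinear.bounded_linear_right[OF bounded_bilinear_matrix_mult] bounded_linear_adj2])
  have dE: "(\<lambda>q. E ** adj2 (P q)) differentiable at p"
    using bounded_linear.has_derivative[OF adj P(1)[unfolded frechet_derivative_works]] by (rule differentiableI)
  have dPE: "(\<lambda>q. P q ** (E ** adj2 (P q))) differentiable at p"
    using bounded_bilinear.FDERIV[OF bounded_bilinear_matrix_mult P(1)[unfolded frechet_derivative_works] dE[unfolded frechet_derivative_works]]
    by (rule differentiableI)
  have "partial i (\<lambda>q. P q ** (E ** adj2 (P q))) p = P p ** (E ** adj2 (P p ** W)) + (P p ** W) ** (E ** adj2 (P p))"
    using partial_bilinear[OF bounded_bilinear_matrix_mult P(1) dE, where i=i] partial_linear[OF adj P(1), where i=i]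
    by (simp add: P(2))
  also have "\<dots> = P p ** (W ** E - E ** W) ** adj2 (P p)"
    by (simp add: adj2_mult adj2_sl2[OF W] matrix_mul_assoc)
  finally show ?thesis
    using partial_bilinear[OF bounded_bilinear_scaleR r dPE, where i=i] by (simp add: matrix_mul_assoc)
qed

section \<open>Timelike surfaces in null coordinates\<close>

text \<open>The difference \<open>W\<close> of the two sides is orthogonal to \<open>A\<close>,
  \<open>B\<close> and \<open>C\<close>; these are linearly independent in the three-dimensional
  space \<open>sl2\<close>, so \<open>W\<close> vanishes.\<close>

lemma null_frame_expansion:
  assumes sl2: "A \<in> sl2" "B \<in> sl2" "C \<in> sl2" "X \<in> sl2"
    and gram: "mink A A = 0" "mink B B = 0" "mink A B = e / 2" "mink A C = 0" "mink B C = 0" "mink C C = 1"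
    and e: "e \<noteq> 0"
  shows "X = (2 / e * mink X B) *\<^sub>R A + (2 / e * mink X A) *\<^sub>R B + mink X C *\<^sub>R C"
proof -
  define W where "W = X - ((2 / e * mink X B) *\<^sub>R A + (2 / e * mink X A) *\<^sub>R B + mink X C *\<^sub>R C)"
  have tr: "Y $ 2 $ 2 = - Y $ 1 $ 1" if "Y \<in> sl2" for Y
    using that by (simp add: sl2_def trace_2 add_eq_0_iff)
  note tr' = tr[OF sl2(1)] tr[OF sl2(2)] tr[OF sl2(3)]
  have W: "W $ 2 $ 2 = - W $ 1 $ 1" by (simp add: W_def tr tr' sl2)
  have orth: "mink W A = 0" "mink W B = 0" "mink W C = 0"
    using e by (simp_all add: gram W_def mink_commute[of B A] mink_commute[of C A] mink_commute[of C B])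
  \<comment> \<open>Determinant of the frame in the coordinates (1,1), (1,2), (2,1) of
    \<open>sl2\<close>. In these the form has determinant -1/4, so \<open>d\<^sup>2\<close> is -4
    times the Gram determinant.\<close>
  define d where "d = A $ 1 $ 1 * (B $ 1 $ 2 * C $ 2 $ 1 - B $ 2 $ 1 * C $ 1 $ 2)
    - A $ 1 $ 2 * (B $ 1 $ 1 * C $ 2 $ 1 - B $ 2 $ 1 * C $ 1 $ 1)
    + A $ 2 $ 1 * (B $ 1 $ 1 * C $ 1 $ 2 - B $ 1 $ 2 * C $ 1 $ 1)"
  have "d\<^sup>2 = - 4 * (mink A A * (mink B B * mink C C - mink B C * mink B C)
    - mink A B * (mink A B * mink C C - mink B C * mink A C)
    + mink A C * (mink A B * mink B C - mink B B * mink A C))"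
    unfolding d_def mink_eq tr' by (simp add: power2_eq_square field_simps)
  then have "d\<^sup>2 = e\<^sup>2" by (simp add: gram power2_eq_square)
  then have d: "d \<noteq> 0" using e by auto
  \<comment> \<open>Cramer's rule for the entries of \<open>W\<close>. The off-diagonal entries
    trade places and carry a factor 1/2, because the form pairs (1,2) with (2,1).\<close>
  have "W $ 1 $ 1 * d = mink W A * (B $ 1 $ 2 * C $ 2 $ 1 - B $ 2 $ 1 * C $ 1 $ 2)
      - mink W B * (A $ 1 $ 2 * C $ 2 $ 1 - A $ 2 $ 1 * C $ 1 $ 2)
      + mink W C * (A $ 1 $ 2 * B $ 2 $ 1 - A $ 2 $ 1 * B $ 1 $ 2)"
    "W $ 2 $ 1 * d / 2 = - (mink W A * (B $ 1 $ 1 * C $ 2 $ 1 - B $ 2 $ 1 * C $ 1 $ 1)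
      - mink W B * (A $ 1 $ 1 * C $ 2 $ 1 - A $ 2 $ 1 * C $ 1 $ 1)
      + mink W C * (A $ 1 $ 1 * B $ 2 $ 1 - A $ 2 $ 1 * B $ 1 $ 1))"
    "W $ 1 $ 2 * d / 2 = mink W A * (B $ 1 $ 1 * C $ 1 $ 2 - B $ 1 $ 2 * C $ 1 $ 1)
      - mink W B * (A $ 1 $ 1 * C $ 1 $ 2 - A $ 1 $ 2 * C $ 1 $ 1)
      + mink W C * (A $ 1 $ 1 * B $ 1 $ 2 - A $ 1 $ 2 * B $ 1 $ 1)"
    unfolding d_def mink_eq tr' W by (simp_all add: field_simps)
  then have "W = 0"
    using d W by (intro mat2_eqI) (simp_all add: orth)
  then show ?thesis by (simp add: W_def)
qed

lemma partial_in_sl2: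
  assumes "open S" "p \<in> S" "X ` S \<subseteq> sl2" "X differentiable at p"
  shows "partial i X p \<in> sl2"
proof -
  have tr: "trace Y = 2 * mink Y (mat 1)" for Y :: "real^2^2" by (simp add: mink_def)
  have "bounded_linear (\<lambda>Y::real^2^2. trace Y)"
    unfolding tr by (intro bounded_linear_const_mult bounded_bilinear.bounded_linear_left[OF bounded_bilinear_mink])
  then have "trace (partial i X p) = partial i (\<lambda>q. trace (X q)) p"
    using partial_linear assms(4) by metis
  also have "\<dots> = partial i (\<lambda>q. 0) p"
    by (rule partial_cong[OF assms(1,2)]) (use assms(3) in \<open>auto simp: sl2_def\<close>)
  finally show ?thesis by (simp add: sl2_def)
qed

lemma differentiable_exp_scaled:
  fixes h :: "real^2 \<Rightarrow> real"
  assumes "h differentiable at p"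
  shows "(\<lambda>q. exp (c * h q)) differentiable at p"
  using has_derivative_exp[OF has_derivative_mult_right[OF assms[unfolded frechet_derivative_works]]]
  by (rule differentiableI)

lemma partial_mink:
  assumes "X differentiable at p" "Y differentiable at p"
  shows "partial i (\<lambda>q. mink (X q) (Y q)) p = mink (X p) (partial i Y p) + mink (partial i X p) (Y p)"
  by (rule partial_bilinear[OF bounded_bilinear_mink assms])

text \<open>Instantiated both by the given surface and by the one from the Sym formula; for the
  latter, immersion and signature are derived from the null metric in
  \<open>timelike\<close>.\<close>

locale null_surface =
  fixes D :: "(real^2) set" and F N :: "real^2 \<Rightarrow> real^2^2" and \<omega> :: "real^2 \<Rightarrow> real"
  assumes D: "open D" and F_sl2: "F ` D \<subseteq> sl2" and F: "smooth_on D F"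
    and normal: "unit_normal_field D F N" and null: "null_coordinates D F \<omega>"
begin

abbreviation (input) "Fu \<equiv> partial 1 F"
abbreviation (input) "Fv \<equiv> partial 2 F"
abbreviation (input) "Q \<equiv> hopf_Q F N"
abbreviation (input) "R \<equiv> hopf_R F N"

text \<open>Mixed coefficient of the second fundamental form, equal to
  \<open>H * exp \<omega> / 2\<close> by \<open>curvatures\<close>.\<close>

definition h :: "real^2 \<Rightarrow> real" where
  "h p = mink (partial 1 Fv p) (N p)"

lemma N: "smooth_on D N" and N_sl2: "N ` D \<subseteq> sl2"
  using normal by (simp_all add: unit_normal_field_def)

lemma \<omega>: "smooth_on D \<omega>"
  using null by (simp add: null_coordinates_def)

lemmas smooths = F N \<omega> F[THEN smooth_on_partial[OF _ D]] \<omega>[THEN smooth_on_partial[OF _ D]]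
  F[THEN smooth_on_partial[OF _ D], THEN smooth_on_partial[OF _ D]]

lemma smooth_mink: "smooth_on D X \<Longrightarrow> smooth_on D Y \<Longrightarrow> smooth_on D (\<lambda>p. mink (X p) (Y p))"
  by (rule smooth_on_bilinear[OF bounded_bilinear_mink D])

lemma smooth_QRh: "smooth_on D Q" "smooth_on D R" "smooth_on D h"
  unfolding hopf_Q_def[abs_def] hopf_R_def[abs_def] h_def[abs_def] by (intro smooth_mink smooths)+

lemma diff: "smooth_on D X \<Longrightarrow> p \<in> D \<Longrightarrow> X differentiable at p"
  by (rule smooth_on_differentiable[OF _ D])

lemma dF: "p \<in> D \<Longrightarrow> frechet_derivative F (at p) x = (x $ 1) *\<^sub>R Fu p + (x $ 2) *\<^sub>R Fv p"
  by (intro frechet_derivative_eq_partials diff F)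

lemma dN: "p \<in> D \<Longrightarrow> frechet_derivative N (at p) x = (x $ 1) *\<^sub>R partial 1 N p + (x $ 2) *\<^sub>R partial 2 N p"
  by (intro frechet_derivative_eq_partials diff N)

text \<open>\<open>null_coordinates\<close> speaks only of the quadratic form; evaluating it at
  (1,0), (0,1) and (1,1) recovers the bilinear coefficients.\<close>

lemma metric:
  assumes "p \<in> D"
  shows "mink (Fu p) (Fu p) = 0" "mink (Fv p) (Fv p) = 0" "mink (Fu p) (Fv p) = exp (\<omega> p) / 2"
proof -
  have I: "mink (Fu p) (Fu p) * (x $ 1)^2 + 2 * mink (Fu p) (Fv p) * (x $ 1) * (x $ 2) + mink (Fv p) (Fv p) * (x $ 2)^2
      = exp (\<omega> p) * (x $ 1) * (x $ 2)" for x :: "real^2"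
  proof -
    have "first_form F p x x = exp (\<omega> p) * (x $ 1) * (x $ 2)"
      using null assms by (simp add: null_coordinates_def)
    then show ?thesis
      by (simp add: first_form_def dF[OF assms] mink_commute[of "Fv p" "Fu p"] power2_eq_square algebra_simps)
  qed
  show "mink (Fu p) (Fu p) = 0" "mink (Fv p) (Fv p) = 0" "mink (Fu p) (Fv p) = exp (\<omega> p) / 2"
    using I[of "vector [1, 0]"] I[of "vector [0, 1]"] I[of "vector [1, 1]"] by simp_all
qed

lemma normal_products:
  assumes "p \<in> D"
  shows "mink (Fu p) (N p) = 0" "mink (Fv p) (N p) = 0" "mink (N p) (N p) = 1"
proof -
  have "mink (frechet_derivative F (at p) x) (N p) = 0" for x
    using normal assms by (simp add: unit_normal_field_def)
  then show "mink (Fu p) (N p) = 0" "mink (Fv p) (N p) = 0" by (simp_all add: partial_def)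
  show "mink (N p) (N p) = 1" using normal assms by (simp add: unit_normal_field_def)
qed

lemma product_rule:
  assumes "smooth_on D X" "smooth_on D Y" "\<And>q. q \<in> D \<Longrightarrow> mink (X q) (Y q) = c q" "p \<in> D"
  shows "mink (partial i X p) (Y p) + mink (X p) (partial i Y p) = partial i c p"
  using partial_cong[OF D assms(4,3), where i=i]
    partial_mink[OF diff[OF assms(1,4)] diff[OF assms(2,4)], where i=i] by simp

lemma conformal_factor:
  assumes "p \<in> D"
  shows "(\<lambda>q. exp (\<omega> q) / 2) differentiable at p"
    and "partial i (\<lambda>q. exp (\<omega> q) / 2) p = partial i \<omega> p * exp (\<omega> p) / 2"
proof -
  have e: "(\<lambda>q. exp (\<omega> q)) differentiable at p"
    using differentiable_exp_scaled[OF diff[OF \<omega> assms], of 1] by simp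
  show "(\<lambda>q. exp (\<omega> q) / 2) differentiable at p"
    by (intro differentiable_divide e) auto
  show "partial i (\<lambda>q. exp (\<omega> q) / 2) p = partial i \<omega> p * exp (\<omega> p) / 2"
    using partial_linear[OF bounded_linear_divide[of 2] e, where i=i] partial_exp[OF diff[OF \<omega> assms], where c=1 and i=i]
    by simp
qed

lemma mixed: "p \<in> D \<Longrightarrow> partial 2 Fu p = partial 1 Fv p"
  by (rule partial_commute[OF F D])

text \<open>Each of the three relations in \<open>metric\<close> is differentiated in both
  directions. Together with equality of the mixed partials, the six equations determine all
  tangential components of the second derivatives.\<close>

lemma second_derivative_products:
  assumes p: "p \<in> D"
  shows "mink (partial 1 Fu p) (Fu p) = 0" "mink (partial 1 Fu p) (Fv p) = partial 1 \<omega> p * exp (\<omega> p) / 2"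
    "mink (partial 1 Fv p) (Fu p) = 0" "mink (partial 1 Fv p) (Fv p) = 0"
    "mink (partial 2 Fv p) (Fu p) = partial 2 \<omega> p * exp (\<omega> p) / 2" "mink (partial 2 Fv p) (Fv p) = 0"
  using product_rule[OF smooths(4,4) metric(1) p, where i=1] product_rule[OF smooths(4,4) metric(1) p, where i=2]
    product_rule[OF smooths(4,4) metric(2) p, where i=1] product_rule[OF smooths(4,4) metric(2) p, where i=2]
    product_rule[OF smooths(4,4) metric(3) p, where i=1] product_rule[OF smooths(4,4) metric(3) p, where i=2]
  by (simp_all add: mixed p conformal_factor mink_commute[of "Fu p" "partial i (partial j F) p" for i j] mink_commute[of "Fv p" "partial i (partial j F) p" for i j])

lemma normal_derivative_products:
  assumes p: "p \<in> D"
  shows "mink (partial 1 N p) (N p) = 0" "mink (partial 2 N p) (N p) = 0"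
    "mink (partial 1 N p) (Fu p) = - Q p" "mink (partial 1 N p) (Fv p) = - h p"
    "mink (partial 2 N p) (Fu p) = - h p" "mink (partial 2 N p) (Fv p) = - R p"
  using product_rule[OF N N normal_products(3) p, where i=1] product_rule[OF N N normal_products(3) p, where i=2]
    product_rule[OF smooths(4) N normal_products(1) p, where i=1] product_rule[OF smooths(4) N normal_products(1) p, where i=2]
    product_rule[OF smooths(4) N normal_products(2) p, where i=1] product_rule[OF smooths(4) N normal_products(2) p, where i=2]
  by (simp_all add: mixed p h_def hopf_Q_def hopf_R_def mink_commute[of "Fu p" "partial i N p" for i]
      mink_commute[of "Fv p" "partial i N p" for i] mink_commute[of "N p" "partial i N p" for i])

lemma in_sl2:
  assumes "p \<in> D"
  shows "F p \<in> sl2" "N p \<in> sl2" "partial i F p \<in> sl2" "partial i N p \<in> sl2" "partial i (partial j F) p \<in> sl2"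
proof -
  have "partial k F q \<in> sl2" if "q \<in> D" for q k
    by (rule partial_in_sl2[OF D that F_sl2 diff[OF F that]])
  then have "partial k F ` D \<subseteq> sl2" for k by blast
  then show "partial i F p \<in> sl2" "partial i (partial j F) p \<in> sl2"
    using assms by (auto intro!: partial_in_sl2[OF D assms] diff smooths simp: image_subset_iff)
  show "partial i N p \<in> sl2"
    by (rule partial_in_sl2[OF D assms N_sl2 diff[OF N assms]])
qed (use assms F_sl2 N_sl2 in auto)

lemma frame_expansion:
  assumes "p \<in> D" "X \<in> sl2"
  shows "X = (2 / exp (\<omega> p) * mink X (Fv p)) *\<^sub>R Fu p + (2 / exp (\<omega> p) * mink X (Fu p)) *\<^sub>R Fv p
    + mink X (N p) *\<^sub>R N p"
  by (rule null_frame_expansion) (simp_all add: assms in_sl2 metric normal_products)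

lemma gauss_weingarten:
  assumes p: "p \<in> D"
  shows "partial 1 Fu p = partial 1 \<omega> p *\<^sub>R Fu p + Q p *\<^sub>R N p"
    and "partial 1 Fv p = h p *\<^sub>R N p"
    and "partial 2 Fu p = h p *\<^sub>R N p"
    and "partial 2 Fv p = partial 2 \<omega> p *\<^sub>R Fv p + R p *\<^sub>R N p"
    and "partial 1 N p = (- 2 / exp (\<omega> p)) *\<^sub>R (h p *\<^sub>R Fu p + Q p *\<^sub>R Fv p)"
    and "partial 2 N p = (- 2 / exp (\<omega> p)) *\<^sub>R (R p *\<^sub>R Fu p + h p *\<^sub>R Fv p)"
  using frame_expansion[OF p in_sl2(5)[OF p, where i=1 and j=1]] frame_expansion[OF p in_sl2(5)[OF p, where i=1 and j=2]]
    frame_expansion[OF p in_sl2(5)[OF p, where i=2 and j=2]]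
    frame_expansion[OF p in_sl2(4)[OF p, where i=1]] frame_expansion[OF p in_sl2(4)[OF p, where i=2]]
  by (simp_all add: mixed p second_derivative_products normal_derivative_products scaleR_add_right
      hopf_Q_def[of F N p] hopf_R_def[of F N p] h_def[of p])

lemma dF_eq_iff:
  assumes p: "p \<in> D"
  shows "a *\<^sub>R Fu p + b *\<^sub>R Fv p = c *\<^sub>R Fu p + d *\<^sub>R Fv p \<longleftrightarrow> a = c \<and> b = d"
proof
  assume "a *\<^sub>R Fu p + b *\<^sub>R Fv p = c *\<^sub>R Fu p + d *\<^sub>R Fv p"
  then have "mink (a *\<^sub>R Fu p + b *\<^sub>R Fv p) X = mink (c *\<^sub>R Fu p + d *\<^sub>R Fv p) X" for X by simp
  from this[of "Fu p"] this[of "Fv p"] show "a = c \<and> b = d"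
    by (simp add: metric p mink_commute[of "Fv p" "Fu p"])
qed simp

text \<open>The Weingarten equations give the components of \<open>- dN\<close> in the basis
  \<open>Fu\<close>, \<open>Fv\<close>; its linear independence gives the uniqueness required by
  \<open>THE\<close>.\<close>

lemma shape_operator_eq:
  assumes p: "p \<in> D"
  shows "shape_operator F N p = (\<lambda>x. (2 / exp (\<omega> p)) *\<^sub>R vector [h p * x $ 1 + R p * x $ 2, Q p * x $ 1 + h p * x $ 2])"
    (is "_ = ?S")
proof -
  have S: "linear ?S"
    by (rule linearI) (simp_all add: vec_eq_iff forall_2 field_simps)
  have eq: "frechet_derivative F (at p) (S x) = - frechet_derivative N (at p) x \<longleftrightarrow> S x = ?S x" for S x
  proof -
    have "- frechet_derivative N (at p) x = (?S x $ 1) *\<^sub>R Fu p + (?S x $ 2) *\<^sub>R Fv p"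
      by (simp add: dN p gauss_weingarten algebra_simps)
    then show ?thesis
      by (simp only: dF[OF p] dF_eq_iff[OF p] vec_eq_iff[of "S x"] forall_2)
  qed
  show ?thesis
    unfolding shape_operator_def eq fun_eq_iff[symmetric]
    by (rule the_equality) (use S in auto)
qed

lemma curvatures:
  assumes p: "p \<in> D"
  shows "mean_curvature F N p = 2 * h p / exp (\<omega> p)"
    and "gauss_curvature F N p = 4 * ((h p)\<^sup>2 - Q p * R p) / (exp (\<omega> p))\<^sup>2"
  by (simp_all add: mean_curvature_def gauss_curvature_def shape_operator_eq p trace_2 det_2 matrix_def axis_def
      power2_eq_square field_simps)

text \<open>Besides the two Codazzi equations, the third claim is the Gauss equation. All come from
  computing third derivatives of \<open>F\<close> by way of \<open>F_uv = h N\<close>: normal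
  components give Codazzi, and the product of \<open>F_uuv\<close> with \<open>Fv\<close> gives
  Gauss.\<close>

lemma codazzi:
  assumes p: "p \<in> D"
  shows "partial 2 Q p = partial 1 h p - partial 1 \<omega> p * h p"
    and "partial 1 R p = partial 2 h p - partial 2 \<omega> p * h p"
    and "partial 2 (partial 1 \<omega>) p = 2 * (Q p * R p - (h p)\<^sup>2) / exp (\<omega> p)"
proof -
  have dhN: "partial i (\<lambda>q. h q *\<^sub>R N q) p = h p *\<^sub>R partial i N p + partial i h p *\<^sub>R N p" for i
    by (rule partial_bilinear[OF bounded_bilinear_scaleR diff[OF smooth_QRh(3) p] diff[OF N p]])
  have Fuuv: "partial 2 (partial 1 Fu) p = h p *\<^sub>R partial 1 N p + partial 1 h p *\<^sub>R N p"
    using partial_commute[OF smooths(4)[of 1] D p, of 2 1] partial_cong[OF D p gauss_weingarten(3), where i=1] dhN by simp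
  have Fvvu: "partial 1 (partial 2 Fv) p = h p *\<^sub>R partial 2 N p + partial 2 h p *\<^sub>R N p"
    using partial_commute[OF smooths(4)[of 2] D p, of 1 2] partial_cong[OF D p gauss_weingarten(2), where i=2] dhN by simp
  note products = metric[OF p] normal_products[OF p] mink_commute[of "N p" "Fu p"] mink_commute[of "N p" "Fv p"]
    mink_commute[of "Fv p" "Fu p"]
  have "partial 2 Q p = mink (partial 1 Fu p) (partial 2 N p) + mink (partial 2 (partial 1 Fu) p) (N p)"
    unfolding hopf_Q_def[abs_def] by (rule partial_mink) (intro diff smooths p)+
  then show "partial 2 Q p = partial 1 h p - partial 1 \<omega> p * h p"
    unfolding Fuuv gauss_weingarten[OF p] by (simp add: products)
  have "partial 1 R p = mink (partial 2 Fv p) (partial 1 N p) + mink (partial 1 (partial 2 Fv) p) (N p)"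
    unfolding hopf_R_def[abs_def] by (rule partial_mink) (intro diff smooths p)+
  then show "partial 1 R p = partial 2 h p - partial 2 \<omega> p * h p"
    unfolding Fvvu gauss_weingarten[OF p] by (simp add: products)
  have "mink (partial 2 (partial 1 Fu) p) (Fv p) + mink (partial 1 Fu p) (partial 2 Fv p)
      = partial 2 (\<lambda>q. partial 1 \<omega> q * (exp (\<omega> q) / 2)) p"
    by (rule product_rule[OF smooths(6) smooths(4) _ p]) (simp add: second_derivative_products)
  also have "\<dots> = partial 1 \<omega> p * (partial 2 \<omega> p * exp (\<omega> p) / 2) + partial 2 (partial 1 \<omega>) p * (exp (\<omega> p) / 2)"
    using partial_bilinear[OF bounded_bilinear_mult diff[OF smooths(5) p] conformal_factor(1)[OF p], where i=2]
    by (simp add: conformal_factor p)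
  finally have "partial 2 (partial 1 \<omega>) p * (exp (\<omega> p) / 2) = Q p * R p - h p * h p"
    unfolding Fuuv gauss_weingarten[OF p] by (simp add: products algebra_simps)
  then show "partial 2 (partial 1 \<omega>) p = 2 * (Q p * R p - (h p)\<^sup>2) / exp (\<omega> p)"
    by (simp add: field_simps power2_eq_square)
qed

lemma timelike: "connected D \<Longrightarrow> timelike_surface D F"
  unfolding timelike_surface_def
proof (intro conjI ballI D F F_sl2)
  fix p assume p: "p \<in> D"
  show "inj (frechet_derivative F (at p))"
  proof (rule injI)
    fix x y assume "frechet_derivative F (at p) x = frechet_derivative F (at p) y"
    then have "x $ 1 = y $ 1 \<and> x $ 2 = y $ 2" by (simp only: dF[OF p] dF_eq_iff[OF p])
    then show "x = y" by (simp add: vec_eq_iff forall_2)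
  qed
  have bil: "bilinear (first_form F p)"
    unfolding bilinear_def first_form_def
    by (auto intro!: linearI simp: dF p algebra_simps)
  \<comment> \<open>With this scale the vectors \<open>(s, -s)\<close> and \<open>(s, s)\<close>
    form an orthonormal pair of signs -1 and +1.\<close>
  define s where "s = exp (- \<omega> p / 2)"
  have "s * s * exp (\<omega> p) = 1" by (simp add: s_def flip: exp_add)
  then have "first_form F p (vector [s, - s]) (vector [s, - s]) = -1"
    "first_form F p (vector [s, s]) (vector [s, s]) = 1"
    "first_form F p (vector [s, - s]) (vector [s, s]) = 0"
    by (simp_all add: first_form_def dF p metric mink_commute[of "Fv p" "Fu p"] algebra_simps)
  moreover have "first_form F p x y = first_form F p y x" for x y
    unfolding first_form_def by (rule mink_commute)
  ultimately show "lorentzian (first_form F p)"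
    unfolding lorentzian_def using bil by blast
qed

end

section \<open>Surfaces with the same fundamental forms are congruent\<close>

lemma partials_zero_imp_constant:
  fixes X :: "real^2 \<Rightarrow> 'b::real_normed_vector"
  assumes "open D" "connected D" and diff: "\<And>p. p \<in> D \<Longrightarrow> X differentiable at p"
    and zero: "\<And>p i. p \<in> D \<Longrightarrow> partial i X p = 0" and "p \<in> D" "q \<in> D"
  shows "X p = X q"
proof (rule has_derivative_zero_unique_connected[OF assms(1,2) _ assms(5,6)])
  fix p assume p: "p \<in> D"
  have "frechet_derivative X (at p) = (\<lambda>x. 0)"
    using frechet_derivative_eq_partials[OF diff[OF p]] zero[OF p] by auto
  then show "(X has_derivative (\<lambda>x. 0)) (at p)"
    using diff[OF p] unfolding frechet_derivative_works by simp
qed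

text \<open>
  The linear map \<open>L p\<close> carries the moving frame of the first surface at \<open>p\<close> to that of the second.
  Both frames satisfy the same Gauss-Weingarten equations, so \<open>L\<close> does not depend on \<open>p\<close>.
\<close>

lemma congruent_null_surfaces:
  assumes S: "null_surface D F N \<omega>" and S': "null_surface D F' N' \<omega>"
    and same: "\<And>p. p \<in> D \<Longrightarrow> hopf_Q F' N' p = hopf_Q F N p" "\<And>p. p \<in> D \<Longrightarrow> hopf_R F' N' p = hopf_R F N p"
      "\<And>p. p \<in> D \<Longrightarrow> mean_curvature F' N' p = mean_curvature F N p"
    and D: "connected D"
  shows "\<exists>T. mink_isometry T \<and> (\<forall>p\<in>D. F' p = T (F p))"
proof (cases "D = {}")
  case True
  have "mink_isometry (\<lambda>X. X)"
    unfolding mink_isometry_def by (rule exI[of _ "\<lambda>X. X"], rule exI[of _ 0]) (auto simp: linear_ident sl2_def trace_2)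
  with True show ?thesis by auto
next
  case False
  then obtain z where z: "z \<in> D" by blast
  interpret S: null_surface D F N \<omega> by fact
  interpret S': null_surface D F' N' \<omega> by fact
  have same_h: "S'.h p = S.h p" if "p \<in> D" for p
    using same(3)[OF that] S.curvatures(1)[OF that] S'.curvatures(1)[OF that] by simp
  \<comment> \<open>The coefficient \<open>2 / exp (\<omega> q)\<close> of
    \<open>frame_expansion\<close>, written without a quotient so that \<open>partial_exp\<close>
    applies.\<close>
  define e where "e q = 2 * exp ((- 1) * \<omega> q)" for q
  have e_eq: "2 / exp (\<omega> q) = e q" for q
    by (simp add: e_def exp_minus field_simps)
  have eE: "e q * (exp (\<omega> q) / 2) = 1" for q
    by (simp add: e_def flip: exp_add)
  have e_diff: "e differentiable at p" and e_part: "partial i e p = - partial i \<omega> p * e p" if "p \<in> D" for p i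
  proof -
    have x: "(\<lambda>q. exp ((- 1) * \<omega> q)) differentiable at p"
      by (rule differentiable_exp_scaled[OF S.diff[OF S.\<omega> that]])
    show "e differentiable at p" unfolding e_def[abs_def] by (intro differentiable_mult x) auto
    show "partial i e p = - partial i \<omega> p * e p"
      using partial_linear[OF bounded_linear_mult_right[of 2] x, where i=i]
        partial_exp[OF S.diff[OF S.\<omega> that], where c="-1" and i=i]
      unfolding e_def[abs_def] by simp
  qed
  \<comment> \<open>Expand \<open>X\<close> in the first frame by \<open>frame_expansion\<close>,
    then substitute the second frame.\<close>
  define L where "L p X = e p *\<^sub>R (mink X (S.Fv p) *\<^sub>R S'.Fu p) + e p *\<^sub>R (mink X (S.Fu p) *\<^sub>R S'.Fv p)
    + mink X (N p) *\<^sub>R N' p" for p X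
  have term_diff: "(\<lambda>q. mink X (G q) *\<^sub>R G' q) differentiable at p"
    and term_part: "partial i (\<lambda>q. mink X (G q) *\<^sub>R G' q) p
      = mink X (G p) *\<^sub>R partial i G' p + mink X (partial i G p) *\<^sub>R G' p"
    if "smooth_on D G" "smooth_on D G'" "p \<in> D" for G G' :: "real^2 \<Rightarrow> real^2^2" and X p i
  proof -
    note G = S.diff[OF that(1,3)] S.diff[OF that(2,3)]
    have m: "(\<lambda>q. mink X (G q)) differentiable at p"
      by (rule S.diff[OF S.smooth_mink[OF smooth_on_const[OF S.D] that(1)] that(3)])
    show "(\<lambda>q. mink X (G q) *\<^sub>R G' q) differentiable at p"
      using m G(2) by (rule differentiable_scaleR)
    have "partial i (\<lambda>q. mink X (G q)) p = mink X (partial i G p)"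
      by (rule partial_linear[OF bounded_bilinear.bounded_linear_right[OF bounded_bilinear_mink] G(1)])
    then show "partial i (\<lambda>q. mink X (G q) *\<^sub>R G' q) p
      = mink X (G p) *\<^sub>R partial i G' p + mink X (partial i G p) *\<^sub>R G' p"
      using partial_bilinear[OF bounded_bilinear_scaleR m G(2), where i=i] by simp
  qed
  note sm = S.smooths(4)[of 1] S.smooths(4)[of 2] S'.smooths(4)[of 1] S'.smooths(4)[of 2]
  have L_diff: "(\<lambda>q. L q X) differentiable at p" if "p \<in> D" for p X
    unfolding L_def
    by (intro differentiable_add differentiable_scaleR e_diff that term_diff sm S.N S'.N)
  have L_part: "partial i (\<lambda>q. L q X) p = 0" if p: "p \<in> D" for p X i
  proof -
    note t1 = term_diff[OF sm(2,3) p, of X] and t2 = term_diff[OF sm(1,4) p, of X] and t3 = term_diff[OF S.N S'.N p, of X]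
    note e1 = differentiable_scaleR[OF e_diff[OF p] t1] and e2 = differentiable_scaleR[OF e_diff[OF p] t2]
    have expand: "partial j (\<lambda>q. L q X) p =
       (e p *\<^sub>R (mink X (S.Fv p) *\<^sub>R partial j S'.Fu p + mink X (partial j S.Fv p) *\<^sub>R S'.Fu p)
         - (partial j \<omega> p * e p) *\<^sub>R (mink X (S.Fv p) *\<^sub>R S'.Fu p))
       + (e p *\<^sub>R (mink X (S.Fu p) *\<^sub>R partial j S'.Fv p + mink X (partial j S.Fu p) *\<^sub>R S'.Fv p)
         - (partial j \<omega> p * e p) *\<^sub>R (mink X (S.Fu p) *\<^sub>R S'.Fv p))
       + (mink X (N p) *\<^sub>R partial j N' p + mink X (partial j N p) *\<^sub>R N' p)" for j
      unfolding L_def partial_add[OF differentiable_add[OF e1 e2] t3] partial_add[OF e1 e2]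
        partial_bilinear[OF bounded_bilinear_scaleR e_diff[OF p] t1]
        partial_bilinear[OF bounded_bilinear_scaleR e_diff[OF p] t2]
        term_part[OF sm(2,3) p] term_part[OF sm(1,4) p] term_part[OF S.N S'.N p] e_part[OF p]
      by simp
    have minus: "- 2 / exp (\<omega> p) = - e p" using e_eq[of p] by simp
    note gw = S.gauss_weingarten[OF p, unfolded minus]
      S'.gauss_weingarten[OF p, unfolded minus same(1)[OF p] same(2)[OF p] same_h[OF p]]
    consider "i = 1" | "i = 2" using exhaust_2 by blast
    then show ?thesis
    proof cases
      case 1
      \<comment> \<open>The derivative of \<open>e\<close> absorbs the \<open>\<omega>\<close> terms
        of the Gauss equations; the remaining \<open>Q\<close> and \<open>h\<close> terms cancel
        against those from the derivatives of the normals.\<close>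
      show ?thesis unfolding 1 expand gw by (simp add: algebra_simps)
    next
      case 2
      show ?thesis unfolding 2 expand gw by (simp add: algebra_simps)
    qed
  qed
  have L_const: "L p X = L z X" if "p \<in> D" for p X
    using partials_zero_imp_constant[OF S.D D L_diff L_part that z] .
  have L_linear: "linear (L p)" for p
    by (rule linearI) (simp_all add: L_def algebra_simps)
  have L_frame: "L p (partial i F p) = partial i F' p" if p: "p \<in> D" for p i
  proof -
    have "L p (S.Fu p) = (e p * (exp (\<omega> p) / 2)) *\<^sub>R S'.Fu p" "L p (S.Fv p) = (e p * (exp (\<omega> p) / 2)) *\<^sub>R S'.Fv p"
      by (simp_all add: L_def S.metric p S.normal_products mink_commute[of "S.Fv p" "S.Fu p"])
    then show ?thesis using exhaust_2[of i] eE by auto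
  qed
  have sl2_iff: "Y \<in> sl2 \<longleftrightarrow> mink Y (mat 1) = 0" for Y
    by (simp add: sl2_def mink_def)
  have L_sl2: "L z X \<in> sl2" for X
    using S'.in_sl2[OF z, unfolded sl2_iff] unfolding sl2_iff by (simp add: L_def)
  have L_mink: "mink (L z X) (L z Y) = mink X Y" if X: "X \<in> sl2" and Y: "Y \<in> sl2" for X Y
  proof -
    have "mink X Y = mink ((e z * mink X (S.Fv z)) *\<^sub>R S.Fu z + (e z * mink X (S.Fu z)) *\<^sub>R S.Fv z + mink X (N z) *\<^sub>R N z) Y"
      using S.frame_expansion[OF z X] by (simp only: e_eq)
    also have "\<dots> = e z * (mink X (S.Fv z) * mink Y (S.Fu z) + mink X (S.Fu z) * mink Y (S.Fv z)) + mink X (N z) * mink Y (N z)"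
      by (simp add: mink_commute[of _ Y] algebra_simps)
    also have "\<dots> = mink (L z X) (L z Y)"
    proof -
      have "mink (L z X) (L z Y) = e z * (e z * (exp (\<omega> z) / 2)) *
          (mink X (S.Fv z) * mink Y (S.Fu z) + mink X (S.Fu z) * mink Y (S.Fv z)) + mink X (N z) * mink Y (N z)"
        by (simp add: L_def S'.metric[OF z] S'.normal_products[OF z] mink_commute[of "S'.Fv z" "S'.Fu z"]
            mink_commute[of "N' z" "S'.Fu z"] mink_commute[of "N' z" "S'.Fv z"] algebra_simps)
      then show ?thesis by (simp only: eE mult_1_right)
    qed
    finally show ?thesis ..
  qed
  \<comment> \<open>With the linear part frozen at \<open>z\<close>, \<open>F'\<close> and the image
    of \<open>F\<close> have equal partials everywhere, so they differ by the translation part of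
    the isometry.\<close>
  have "F' p - L z (F p) = F' z - L z (F z)" if "p \<in> D" for p
  proof (rule partials_zero_imp_constant[OF S.D D _ _ that z])
    fix q i assume q: "q \<in> D"
    have bl: "bounded_linear (\<lambda>X. - L z X)"
      using L_linear[of z] by (intro bounded_linear_minus) (simp add: linear_conv_bounded_linear)
    have LF: "(\<lambda>q. - L z (F q)) differentiable at q"
      using bounded_linear.has_derivative[OF bl S.diff[OF S.F q, unfolded frechet_derivative_works]]
      by (rule differentiableI)
    have F': "F' differentiable at q" by (rule S'.diff[OF S'.F q])
    show "(\<lambda>q. F' q - L z (F q)) differentiable at q"
      using differentiable_add[OF F' LF] by simp
    show "partial i (\<lambda>q. F' q - L z (F q)) q = 0"
      using partial_add[OF F' LF, where i=i] partial_linear[OF bl S.diff[OF S.F q], where i=i]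
        L_frame[OF q] L_const[OF q] by simp
  qed
  then have "F' p = L z (F p) + (F' z - L z (F z))" if "p \<in> D" for p
    using that by (simp add: algebra_simps eq_diff_eq)
  moreover have "F' z - L z (F z) \<in> sl2"
    using S'.in_sl2(1)[OF z] L_sl2 unfolding sl2_iff by simp
  then have "mink_isometry (\<lambda>X. L z X + (F' z - L z (F z)))"
    unfolding mink_isometry_def using L_linear L_sl2 L_mink by blast
  ultimately show ?thesis by blast
qed

section \<open>The Lax pair of a THIMC surface\<close>

locale null_thimc_surface = null_surface D F N \<omega> for D F N \<omega> +
  fixes f g :: "real \<Rightarrow> real"
  assumes connected: "connected D"
    and f: "smooth_on ((\<lambda>p. p $ 1) ` D) f" and g: "smooth_on ((\<lambda>p. p $ 2) ` D) g"
    and nonzero: "\<And>p. p \<in> D \<Longrightarrow> mean_curvature F N p \<noteq> 0"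
    and harmonic: "\<And>p. p \<in> D \<Longrightarrow> mean_curvature F N p = 1 / (f (p $ 1) + g (p $ 2))"
begin

abbreviation (input) "H \<equiv> mean_curvature F N"

lemma sum_nonzero: "p \<in> D \<Longrightarrow> f (p $ 1) + g (p $ 2) \<noteq> 0"
  using nonzero harmonic by fastforce

lemma h_eq: "p \<in> D \<Longrightarrow> h p = H p * exp (\<omega> p) / 2"
  by (simp add: curvatures)

lemma smooth_H: "smooth_on D H"
proof -
  have "smooth_on D (\<lambda>p. inverse (f (p $ 1) + g (p $ 2)))"
    by (intro smooth_on_inverse smooth_on_add smooth_on_coordinate D f g sum_nonzero)
  then show ?thesis
    by (rule iffD2[OF smooth_on_cong, rotated]) (simp add: harmonic inverse_eq_divide)
qed

text \<open>Brings the Codazzi equations to the form \<open>Q_v = H_u exp \<omega> / 2\<close> and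
  its mirror image, since the terms with derivatives of \<omega> cancel.\<close>

lemma partial_h:
  assumes p: "p \<in> D"
  shows "partial i h p = partial i H p * exp (\<omega> p) / 2 + h p * partial i \<omega> p"
proof -
  have "partial i h p = partial i (\<lambda>q. H q * (exp (\<omega> q) / 2)) p"
    by (rule partial_cong[OF D p]) (simp add: h_eq)
  also have "\<dots> = partial i H p * exp (\<omega> p) / 2 + h p * partial i \<omega> p"
    using partial_bilinear[OF bounded_bilinear_mult diff[OF smooth_H p] conformal_factor(1)[OF p], where i=i]
    by (simp add: conformal_factor p h_eq)
  finally show ?thesis .
qed

lemma differentiable_fg:
  assumes "p \<in> D"
  shows "f differentiable (at (p $ 1) within (\<lambda>p. p $ 1) ` D)" "g differentiable (at (p $ 2) within (\<lambda>p. p $ 2) ` D)"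
  using smooth_on_has_derivative[OF f, of "p $ 1"] smooth_on_has_derivative[OF g, of "p $ 2"] assms
  by (auto intro: differentiableI)

text \<open>Denominator and numerator of the spectral parameter, with \<tau> kept as an argument
  because both are later differentiated in it.\<close>

definition a :: "real \<Rightarrow> real^2 \<Rightarrow> real" where "a \<tau> p = 1 + 2 * \<tau> * f (p $ 1)"
definition b :: "real \<Rightarrow> real^2 \<Rightarrow> real" where "b \<tau> p = 1 - 2 * \<tau> * g (p $ 2)"

context
  fixes \<tau> :: real
  assumes adm: "\<tau> \<in> admissible D f g"
begin

abbreviation (input) "l \<equiv> spectral f g \<tau>"

lemma ab_nonzero: "p \<in> D \<Longrightarrow> a \<tau> p \<noteq> 0" "p \<in> D \<Longrightarrow> b \<tau> p \<noteq> 0"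
  using adm by (auto simp: admissible_def a_def b_def)

lemma spectral_eq: "l p = b \<tau> p / a \<tau> p"
  by (simp add: spectral_def a_def b_def)

text \<open>
  Inserting the spectral parameter changes \<open>H\<close> only by a function of one null coordinate, which the
  differentiation in the Codazzi equations does not see.
\<close>

lemma mean_curvature_spectral:
  assumes p: "p \<in> D"
  shows "H p * l p = H p - 2 * \<tau> / a \<tau> p" "H p * inverse (l p) = H p + 2 * \<tau> / b \<tau> p"
  using ab_nonzero[OF p] sum_nonzero[OF p]
  unfolding harmonic[OF p] spectral_eq by (simp_all add: field_simps) (simp_all add: a_def b_def algebra_simps)

text \<open>These are the only cases the zero curvature equation asks for: \<open>H * l\<close> sits
  in the matrix differentiated in \<open>v\<close>, \<open>H * inverse l\<close> in the one
  differentiated in \<open>u\<close>.\<close>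

lemma partial_mean_curvature_spectral:
  assumes p: "p \<in> D"
  shows "(\<lambda>q. H q * l q) differentiable at p" "(\<lambda>q. H q * inverse (l q)) differentiable at p"
    and "partial 2 (\<lambda>q. H q * l q) p = partial 2 H p" "partial 1 (\<lambda>q. H q * inverse (l q)) p = partial 1 H p"
proof -
  have "(\<lambda>x. - 2 * \<tau> / (1 + 2 * \<tau> * f x)) differentiable (at (p $ 1) within (\<lambda>p. p $ 1) ` D)"
    "(\<lambda>x. 2 * \<tau> / (1 - 2 * \<tau> * g x)) differentiable (at (p $ 2) within (\<lambda>p. p $ 2) ` D)"
    using ab_nonzero[OF p] differentiable_fg[OF p]
    by (auto intro!: differentiable_divide differentiable_add differentiable_diff differentiable_mult simp: a_def b_def)
  note A = this(1)[THEN partial_coordinate(1)[OF D p], of 2] this(1)[THEN partial_coordinate(2)[OF D p], of 2]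
    and B = this(2)[THEN partial_coordinate(1)[OF D p], of 1] this(2)[THEN partial_coordinate(2)[OF D p], of 1]
  have eqA: "H q * l q = H q + (- 2 * \<tau> / (1 + 2 * \<tau> * f (q $ 1)))" if "q \<in> D" for q
    using mean_curvature_spectral(1)[OF that] by (simp add: a_def)
  have eqB: "H q * inverse (l q) = H q + 2 * \<tau> / (1 - 2 * \<tau> * g (q $ 2))" if "q \<in> D" for q
    using mean_curvature_spectral(2)[OF that] by (simp add: b_def)
  note dH = diff[OF smooth_H p]
  have tr: "X differentiable at p" if "Y differentiable at p" "\<And>q. q \<in> D \<Longrightarrow> X q = Y q" for X Y :: "real^2 \<Rightarrow> real"
    using that has_derivative_transform_within_open[OF _ D p, of Y _ UNIV X] unfolding differentiable_def by metis
  show "(\<lambda>q. H q * l q) differentiable at p" "(\<lambda>q. H q * inverse (l q)) differentiable at p"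
    by (rule tr[OF differentiable_add[OF dH A(2)] eqA], simp_all)
       (rule tr[OF differentiable_add[OF dH B(2)] eqB], simp_all)
  show "partial 2 (\<lambda>q. H q * l q) p = partial 2 H p"
    using partial_cong[OF D p eqA, where i=2] partial_add[OF dH A(2), where i=2] A(1) by simp
  show "partial 1 (\<lambda>q. H q * inverse (l q)) p = partial 1 H p"
    using partial_cong[OF D p eqB, where i=1] partial_add[OF dH B(2), where i=1] B(1) by simp
qed

text \<open>The off-diagonal entries are the Codazzi equations and the diagonal ones the Gauss
  equation, where \<open>H * l\<close> and \<open>H * inverse l\<close> occur only through their
  product \<open>H * H\<close>.\<close>

lemma compatibility:
  assumes p: "p \<in> D"
  defines "U \<equiv> lax_U F N \<omega> l" and "V \<equiv> lax_V F N \<omega> l"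
  shows "partial 1 V p - partial 2 U p + (U p ** V p - V p ** U p) = 0"
proof -
  define s where "s = exp (\<omega> p / 2)"
  \<comment> \<open>Expressing every exponential through \<open>s\<close> makes all entries rational
    in \<open>s\<close>, so that field arithmetic can finish.\<close>
  have s: "s \<noteq> 0" "exp (- \<omega> p / 2) = 1 / s" "exp (\<omega> p) = s * s"
    by (simp_all add: s_def exp_minus field_simps flip: exp_add)
  define k1 where "k1 q = H q * l q" for q
  define k2 where "k2 q = H q * inverse (l q)" for q
  have k: "k1 p * k2 p = H p * H p"
    using ab_nonzero[OF p] by (simp add: k1_def k2_def spectral_eq)
  note dk = partial_mean_curvature_spectral[OF p, folded k1_def[abs_def] k2_def[abs_def]]
  note dw = diff[OF \<omega> p]
  have e: "(\<lambda>q. exp (\<omega> q / 2)) differentiable at p" "(\<lambda>q. exp (- \<omega> q / 2)) differentiable at p"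
    using differentiable_exp_scaled[OF dw, of "1/2"] differentiable_exp_scaled[OF dw, of "-1/2"] by simp_all
  have ep: "partial i (\<lambda>q. exp (\<omega> q / 2)) p = partial i \<omega> p / 2 * s"
    "partial i (\<lambda>q. exp (- \<omega> q / 2)) p = - partial i \<omega> p / 2 / s" for i
    using partial_exp[OF dw, where c="1/2" and i=i] partial_exp[OF dw, where c="-1/2" and i=i]
    using s(2) by (simp_all add: s_def)
  note mult = partial_bilinear[OF bounded_bilinear_mult] and cm = partial_linear[OF bounded_linear_mult_right]
  note dQ = diff[OF smooth_QRh(1) p] and dR = diff[OF smooth_QRh(2) p]
    and dwi = diff[OF smooths(5) p]
  have Ueq: "U = (\<lambda>q. mat2 ((- (1/4)) * partial 1 \<omega> q) ((- 1) * (Q q * exp (- \<omega> q / 2)))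
      (1/2 * (k1 q * exp (\<omega> q / 2))) (1/4 * partial 1 \<omega> q))"
    and Veq: "V = (\<lambda>q. mat2 (1/4 * partial 2 \<omega> q) ((- (1/2)) * (k2 q * exp (\<omega> q / 2)))
      (R q * exp (- \<omega> q / 2)) ((- (1/4)) * partial 2 \<omega> q))"
    by (auto simp: U_def V_def lax_U_def lax_V_def k1_def k2_def)
  note dm = differentiable_mult[OF differentiable_const]
  note Qe = differentiable_mult[OF dQ e(2)] and Re = differentiable_mult[OF dR e(2)]
    and k1e = differentiable_mult[OF dk(1) e(1)] and k2e = differentiable_mult[OF dk(2) e(1)]
  have dU: "partial 2 U p = mat2 ((- (1/4)) * partial 2 (partial 1 \<omega>) p)
      ((- 1) * (Q p * (- partial 2 \<omega> p / 2 / s) + partial 2 Q p / s))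
      (1/2 * (k1 p * (partial 2 \<omega> p / 2 * s) + partial 2 H p * s)) (1/4 * partial 2 (partial 1 \<omega>) p)"
    unfolding Ueq partial_mat2[OF dm[OF dwi] dm[OF Qe] dm[OF k1e] dm[OF dwi]]
      cm[OF dwi] cm[OF Qe] cm[OF k1e] mult[OF dQ e(2)] mult[OF dk(1) e(1)] ep dk(3) s(2) s_def[symmetric]
    by simp
  have dV: "partial 1 V p = mat2 (1/4 * partial 1 (partial 2 \<omega>) p)
      ((- (1/2)) * (k2 p * (partial 1 \<omega> p / 2 * s) + partial 1 H p * s))
      (R p * (- partial 1 \<omega> p / 2 / s) + partial 1 R p / s) ((- (1/4)) * partial 1 (partial 2 \<omega>) p)"
    unfolding Veq partial_mat2[OF dm[OF dwi] dm[OF k2e] Re dm[OF dwi]]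
      cm[OF dwi] cm[OF k2e] mult[OF dR e(2)] mult[OF dk(2) e(1)] ep dk(4) s(2) s_def[symmetric]
    by simp
  have UV: "U p = mat2 (- (1/4) * partial 1 \<omega> p) (- Q p / s) (k1 p * s / 2) (partial 1 \<omega> p / 4)"
    "V p = mat2 (partial 2 \<omega> p / 4) (- k2 p * s / 2) (R p / s) (- (1/4) * partial 2 \<omega> p)"
    unfolding Ueq Veq s(2) s_def[symmetric] by simp_all
  have mixed_\<omega>: "partial 1 (partial 2 \<omega>) p = partial 2 (partial 1 \<omega>) p"
    by (rule partial_commute[OF \<omega> D p])
  have hp: "h p = H p * s * s / 2" by (simp add: h_eq p s)
  have QvRu: "partial 2 Q p = partial 1 H p * s * s / 2" "partial 1 R p = partial 2 H p * s * s / 2"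
    using codazzi(1,2)[OF p] partial_h[OF p] by (simp_all add: s)
  have g: "partial 2 (partial 1 \<omega>) p = 2 * Q p * R p / (s * s) - k1 p * k2 p * s * s / 2"
    using codazzi(3)[OF p] s(1) unfolding hp s(3) k by (simp add: field_simps power2_eq_square)
  show ?thesis
    unfolding dU dV UV mixed_\<omega> QvRu g
    using s(1) by (intro mat2_eqI) (simp_all add: mat2_mult_nth field_simps)
qed

end

end

section \<open>The Sym formula\<close>

context null_thimc_surface
begin

context
  fixes J :: "real set" and \<Phi> :: "real \<Rightarrow> real^2 \<Rightarrow> real^2^2" and \<tau> :: real
  assumes J: "is_interval J" "interior J \<noteq> {}" "J \<subseteq> admissible D f g"
    and sol: "\<And>t. t \<in> J \<Longrightarrow> lax_solution D F N \<omega> (spectral f g t) (\<Phi> t)"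
    and det: "\<And>t p. t \<in> J \<Longrightarrow> p \<in> D \<Longrightarrow> det (\<Phi> t p) = 1"
    and \<Phi>: "smooth_on (J \<times> D) (\<lambda>(t, p). \<Phi> t p)" and \<tau>: "\<tau> \<in> J"
begin

definition X :: "real^2 \<Rightarrow> real^2^2" where
  "X p = vector_derivative (\<lambda>t. \<Phi> t p) (at \<tau> within J)"

abbreviation (input) "P \<equiv> \<Phi> \<tau>"
abbreviation (input) "F' \<equiv> sym_surface J \<Phi> \<tau>"
abbreviation (input) "N' \<equiv> \<lambda>p. Ad (P p) k'"
abbreviation (input) "U \<equiv> lax_U F N \<omega> (spectral f g \<tau>)"
abbreviation (input) "V \<equiv> lax_V F N \<omega> (spectral f g \<tau>)"
abbreviation (input) "A \<equiv> a \<tau>"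
abbreviation (input) "B \<equiv> b \<tau>"
abbreviation (input) "E21 \<equiv> mat2 0 0 1 0"
abbreviation (input) "E12 \<equiv> mat2 0 1 0 0"

lemmas slices = smooth_on_slice_derivatives[OF J(1,2) D \<Phi> \<tau>, folded X_def]

lemma adm: "\<tau> \<in> admissible D f g" using J(3) \<tau> by blast

lemmas AB_nonzero = ab_nonzero[OF adm]

lemma partial_P: "p \<in> D \<Longrightarrow> partial 1 P p = P p ** U p" "p \<in> D \<Longrightarrow> partial 2 P p = P p ** V p"
  using sol[OF \<tau>] by (simp_all add: lax_solution_def)

lemma UV_sl2: "U p \<in> sl2" "V p \<in> sl2"
  by (simp_all add: sl2_iff lax_U_def lax_V_def)

text \<open>The numerator in the derivative of \<open>t / a\<close> is
  \<open>a - t * (2 * f) = 1\<close>, so \<open>f\<close> survives only in the denominator; likewise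
  for \<open>b\<close> and \<open>g\<close>. The rewriting of \<open>H * l\<close> holds for
  admissible parameters, hence the derivative within \<open>J\<close>.\<close>

lemma spectral_derivatives:
  assumes p: "p \<in> D"
  shows "((\<lambda>t. H p * spectral f g t p) has_real_derivative - 2 / (A p)\<^sup>2) (at \<tau> within J)"
    and "((\<lambda>t. H p * inverse (spectral f g t p)) has_real_derivative 2 / (B p)\<^sup>2) (at \<tau> within J)"
proof -
  have tr: "(y has_real_derivative d) (at \<tau> within J)"
    if "(x has_real_derivative d) (at \<tau> within J)" "\<And>t. t \<in> J \<Longrightarrow> y t = x t" for x y d
    using that has_vector_derivative_transform[OF \<tau>, of y x d]
    by (simp add: has_real_derivative_iff_has_vector_derivative)
  have "((\<lambda>t. H p - 2 * t / a t p) has_real_derivative - 2 / (A p)\<^sup>2) (at \<tau> within J)"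
    using AB_nonzero[OF p] unfolding a_def
    by (auto intro!: derivative_eq_intros simp: field_simps power2_eq_square)
  then show "((\<lambda>t. H p * spectral f g t p) has_real_derivative - 2 / (A p)\<^sup>2) (at \<tau> within J)"
    by (rule tr) (use mean_curvature_spectral(1)[OF _ p] J(3) in blast)
  have "((\<lambda>t. H p + 2 * t / b t p) has_real_derivative 2 / (B p)\<^sup>2) (at \<tau> within J)"
    using AB_nonzero[OF p] unfolding b_def
    by (auto intro!: derivative_eq_intros simp: field_simps power2_eq_square)
  then show "((\<lambda>t. H p * inverse (spectral f g t p)) has_real_derivative 2 / (B p)\<^sup>2) (at \<tau> within J)"
    by (rule tr) (use mean_curvature_spectral(2)[OF _ p] J(3) in blast)
qed

text \<open>The parameter enters the Lax matrix \<open>W\<close> in one entry only, so its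
  derivative is a multiple of \<open>E\<close>. The claim is Leibniz for \<open>\<Phi> ** W\<close>
  after exchanging the parameter derivative with \<open>partial i\<close>.\<close>

lemma partial_X_aux:
  assumes p: "p \<in> D" and W: "\<And>t. t \<in> J \<Longrightarrow> partial i (\<Phi> t) p = \<Phi> t p ** W t"
    and W': "\<And>t. W t = C + (k * m t) *\<^sub>R E" and m: "(m has_real_derivative m') (at \<tau> within J)"
  shows "partial i X p = X p ** W \<tau> + P p ** ((k * m') *\<^sub>R E)"
proof -
  have "((\<lambda>t. k * m t) has_real_derivative k * m') (at \<tau> within J)"
    using m by (auto intro!: derivative_eq_intros)
  from has_vector_derivative_add[OF has_vector_derivative_const has_vector_derivative_scaleR[OF this has_vector_derivative_const]]
  have "(W has_vector_derivative (k * m') *\<^sub>R E) (at \<tau> within J)"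
    unfolding W'[abs_def] by simp
  from bounded_bilinear.has_vector_derivative[OF bounded_bilinear_matrix_mult slices(4)[OF p] this]
  have "((\<lambda>t. \<Phi> t p ** W t) has_vector_derivative P p ** ((k * m') *\<^sub>R E) + X p ** W \<tau>) (at \<tau> within J)" .
  then have "((\<lambda>t. partial i (\<Phi> t) p) has_vector_derivative P p ** ((k * m') *\<^sub>R E) + X p ** W \<tau>) (at \<tau> within J)"
    by (rule has_vector_derivative_transform[OF \<tau> W, rotated])
  from vector_derivative_unique_within[OF slices(1) slices(5)[OF p] this]
  show ?thesis by (simp add: add.commute)
qed

lemma partial_X:
  assumes p: "p \<in> D"
  shows "partial 1 X p = X p ** U p - P p ** ((exp (\<omega> p / 2) / (A p)\<^sup>2) *\<^sub>R E21)"
    and "partial 2 X p = X p ** V p - P p ** ((exp (\<omega> p / 2) / (B p)\<^sup>2) *\<^sub>R E12)"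
proof -
  have "lax_U F N \<omega> (spectral f g t) p = mat2 (- (1/4) * partial 1 \<omega> p) (- Q p * exp (- \<omega> p / 2)) 0 (1/4 * partial 1 \<omega> p)
      + (exp (\<omega> p / 2) / 2 * (H p * spectral f g t p)) *\<^sub>R E21" for t
    by (intro mat2_eqI) (simp_all add: lax_U_def)
  from partial_X_aux[where i=1, OF p _ this spectral_derivatives(1)[OF p]]
  have "partial 1 X p = X p ** U p + P p ** ((exp (\<omega> p / 2) / 2 * (- 2 / (A p)\<^sup>2)) *\<^sub>R E21)"
    using sol p by (simp add: lax_solution_def)
  then show "partial 1 X p = X p ** U p - P p ** ((exp (\<omega> p / 2) / (A p)\<^sup>2) *\<^sub>R E21)" by simp
  have "lax_V F N \<omega> (spectral f g t) p = mat2 (1/4 * partial 2 \<omega> p) 0 (R p * exp (- \<omega> p / 2)) (- (1/4) * partial 2 \<omega> p)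
      + (- exp (\<omega> p / 2) / 2 * (H p * inverse (spectral f g t p))) *\<^sub>R E12" for t
    by (intro mat2_eqI) (simp_all add: lax_V_def)
  from partial_X_aux[where i=2, OF p _ this spectral_derivatives(2)[OF p]]
  have "partial 2 X p = X p ** V p + P p ** ((- exp (\<omega> p / 2) / 2 * (2 / (B p)\<^sup>2)) *\<^sub>R E12)"
    using sol p by (simp add: lax_solution_def)
  then show "partial 2 X p = X p ** V p - P p ** ((exp (\<omega> p / 2) / (B p)\<^sup>2) *\<^sub>R E12)" by simp
qed

lemma F'_eq: "p \<in> D \<Longrightarrow> F' p = - (X p ** adj2 (P p))"
  by (simp add: sym_surface_def X_def matrix_inv_eq_adj2 det \<tau>)

lemma N'_eq: "p \<in> D \<Longrightarrow> N' p = P p ** k' ** adj2 (P p)"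
  by (simp add: Ad_def matrix_inv_eq_adj2 det \<tau>)

lemma smooth_matrix_mult:
  fixes Y Z :: "real^2 \<Rightarrow> real^2^2"
  shows "smooth_on D Y \<Longrightarrow> smooth_on D Z \<Longrightarrow> smooth_on D (\<lambda>p. Y p ** Z p)"
  by (rule smooth_on_bilinear[OF bounded_bilinear_matrix_mult D])

lemma smooth_F': "smooth_on D F'" and smooth_N': "smooth_on D N'"
proof -
  have "smooth_on D (\<lambda>p. - (X p ** adj2 (P p)))"
    by (intro smooth_on_linear[OF bounded_linear_minus[OF bounded_linear_ident] D] smooth_matrix_mult
        smooth_on_linear[OF bounded_linear_adj2 D] slices(2,3))
  from iffD2[OF smooth_on_cong[OF F'_eq] this] show "smooth_on D F'" by simp
  have "smooth_on D (\<lambda>p. P p ** k' ** adj2 (P p))"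
    by (intro smooth_matrix_mult smooth_on_linear[OF bounded_linear_adj2 D] slices(2,3) smooth_on_const D)
  from iffD2[OF smooth_on_cong[OF N'_eq] this] show "smooth_on D N'" by simp
qed

text \<open>Differentiate \<open>\<Phi> ** adj2 \<Phi> = mat 1\<close> in the parameter: the (1,1)
  entry of the resulting identity is exactly the trace of \<open>X ** adj2 P\<close>.\<close>

lemma F'_sl2: "p \<in> D \<Longrightarrow> F' p \<in> sl2"
proof -
  assume p: "p \<in> D"
  have "((\<lambda>t. adj2 (\<Phi> t p)) has_vector_derivative adj2 (X p)) (at \<tau> within J)"
    by (rule bounded_linear.has_vector_derivative[OF bounded_linear_adj2 slices(4)[OF p]])
  from bounded_bilinear.has_vector_derivative[OF bounded_bilinear_matrix_mult slices(4)[OF p] this]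
  have "((\<lambda>t. \<Phi> t p ** adj2 (\<Phi> t p)) has_vector_derivative P p ** adj2 (X p) + X p ** adj2 (P p)) (at \<tau> within J)" .
  moreover have "((\<lambda>t. \<Phi> t p ** adj2 (\<Phi> t p)) has_vector_derivative 0) (at \<tau> within J)"
    by (rule has_vector_derivative_transform[OF \<tau> _ has_vector_derivative_const[of "mat 1"]])
       (simp add: adj2_inverse det p)
  ultimately have "P p ** adj2 (X p) + X p ** adj2 (P p) = 0"
    using vector_derivative_unique_within[OF slices(1)] by blast
  then have "(P p ** adj2 (X p) + X p ** adj2 (P p)) $ 1 $ 1 = 0" by simp
  then show "F' p \<in> sl2"
    by (simp add: F'_eq p sl2_iff mat2_mult_nth algebra_simps)
qed

text \<open>The terms containing \<open>X\<close> cancel, because \<open>adj2\<close> of a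
  trace-free Lax matrix is its negative; what remains is the parameter derivative of the Lax matrix,
  conjugated by \<open>P\<close>.\<close>

lemma partial_F':
  assumes p: "p \<in> D"
  shows "partial 1 F' p = (exp (\<omega> p / 2) / (A p)\<^sup>2) *\<^sub>R (P p ** E21 ** adj2 (P p))"
    and "partial 2 F' p = (exp (\<omega> p / 2) / (B p)\<^sup>2) *\<^sub>R (P p ** E12 ** adj2 (P p))"
proof -
  note dX = diff[OF slices(3) p] and dP = diff[OF slices(2) p]
  have dadj: "(\<lambda>q. adj2 (P q)) differentiable at p"
    using bounded_linear.has_derivative[OF bounded_linear_adj2 dP[unfolded frechet_derivative_works]]
    by (rule differentiableI)
  have dXP: "(\<lambda>q. X q ** adj2 (P q)) differentiable at p"
    using bounded_bilinear.FDERIV[OF bounded_bilinear_matrix_mult dX[unfolded frechet_derivative_works] dadj[unfolded frechet_derivative_works]]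
    by (rule differentiableI)
  have "partial i F' p = - (X p ** adj2 (partial i P p) + partial i X p ** adj2 (P p))" for i
    using partial_cong[OF D p F'_eq, where i=i]
      partial_linear[OF bounded_linear_minus[OF bounded_linear_ident] dXP, where i=i]
      partial_bilinear[OF bounded_bilinear_matrix_mult dX dadj, where i=i]
      partial_linear[OF bounded_linear_adj2 dP, where i=i] by simp
  then show "partial 1 F' p = (exp (\<omega> p / 2) / (A p)\<^sup>2) *\<^sub>R (P p ** E21 ** adj2 (P p))"
    "partial 2 F' p = (exp (\<omega> p / 2) / (B p)\<^sup>2) *\<^sub>R (P p ** E12 ** adj2 (P p))"
    by (simp_all add: partial_P partial_X p adj2_mult adj2_sl2 UV_sl2 matrix_mul_assoc)
qed

lemma mink_basis:
  "mink E21 E21 = 0" "mink E12 E12 = 0" "mink E21 E12 = 1/2" "mink E12 E21 = 1/2" "mink E21 k' = 0" "mink E12 k' = 0"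
  "mink k' k' = 1" "k' \<in> sl2"
  by (simp_all add: mink_eq k'_def sl2_iff)

lemma dF': "p \<in> D \<Longrightarrow> frechet_derivative F' (at p) x = (x $ 1) *\<^sub>R partial 1 F' p + (x $ 2) *\<^sub>R partial 2 F' p"
  by (intro frechet_derivative_eq_partials diff smooth_F')

lemma exp_half: "exp (\<omega> p / 2) * exp (\<omega> p / 2) = exp (\<omega> p)"
  by (simp flip: exp_add)

lemma first_form_F':
  assumes p: "p \<in> D"
  shows "first_form F' p x x = exp (\<omega> p) / ((A p)\<^sup>2 * (B p)\<^sup>2) * (x $ 1) * (x $ 2)"
  unfolding exp_half[symmetric]
  by (simp add: first_form_def dF' p partial_F' mink_conj det \<tau> mink_basis)

lemma normal_F': "unit_normal_field D F' N'"
  unfolding unit_normal_field_def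
proof (intro conjI ballI allI smooth_N')
  show "N' ` D \<subseteq> sl2" using conj_in_sl2[OF det[OF \<tau>]] mink_basis by (auto simp: N'_eq)
  show "mink (N' p) (N' p) = 1" if "p \<in> D" for p
    using that by (simp add: N'_eq mink_conj det \<tau> mink_basis)
  show "mink (frechet_derivative F' (at p) x) (N' p) = 0" if "p \<in> D" for p x
    using that by (simp add: N'_eq dF' partial_F' mink_conj det \<tau> mink_basis)
qed

lemma smooth_AB: "smooth_on D A" "smooth_on D B"
proof -
  note m = smooth_on_linear[OF bounded_linear_mult_right D] and c = smooth_on_const[OF D]
  show "smooth_on D A" unfolding a_def[abs_def]
    by (intro smooth_on_add D c m smooth_on_coordinate f)
  have "smooth_on D (\<lambda>p. 1 + (- 2 * \<tau>) * g (p $ 2))"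
    by (intro smooth_on_add D c m smooth_on_coordinate g)
  then show "smooth_on D B" by (simp add: b_def[abs_def])
qed

text \<open>Exponent of the new conformal factor. \<open>A\<close> and \<open>B\<close> are nonzero
  but of either sign, so only their squares go under \<open>ln\<close>.\<close>

definition \<omega>' :: "real^2 \<Rightarrow> real" where
  "\<omega>' p = \<omega> p + (- 1) * ln ((A p * A p) * (B p * B p))"

lemma exp_\<omega>': "p \<in> D \<Longrightarrow> exp (\<omega>' p) = exp (\<omega> p) / ((A p)\<^sup>2 * (B p)\<^sup>2)"
  using AB_nonzero[of p] by (auto simp: \<omega>'_def exp_diff power2_eq_square zero_less_mult_iff linorder_neq_iff)

lemma null_F': "null_surface D F' N' \<omega>'"
proof
  show "F' ` D \<subseteq> sl2" using F'_sl2 by blast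
  have "A p * A p * (B p * B p) > 0" if "p \<in> D" for p
    using AB_nonzero[OF that] by (auto simp: zero_less_mult_iff linorder_neq_iff)
  then have "smooth_on D \<omega>'"
    unfolding \<omega>'_def[abs_def]
    by (intro smooth_on_add D \<omega> smooth_on_linear[OF bounded_linear_mult_right D] smooth_on_ln
        smooth_on_bilinear[OF bounded_bilinear_mult D] smooth_AB)
  then show "null_coordinates D F' \<omega>'"
    by (simp add: null_coordinates_def first_form_F' exp_\<omega>')
qed (intro D smooth_F' normal_F')+

text \<open>Derivatives of the scalar factors drop out since \<open>E21\<close> and
  \<open>E12\<close> are orthogonal to \<open>k'\<close>. Only the commutator term of
  \<open>partial_conj\<close> is left, and \<open>mink_conj\<close> removes the conjugation by
  \<open>P\<close>.\<close>

lemma second_partials_F':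
  assumes p: "p \<in> D"
  shows "hopf_Q F' N' p = Q p / (A p)\<^sup>2" and "hopf_R F' N' p = R p / (B p)\<^sup>2"
    and "null_surface.h F' N' p = exp (\<omega> p) * H p / (2 * A p * B p)"
proof -
  note dP = diff[OF slices(2) p]
  have e: "(\<lambda>q. exp (\<omega> q / 2)) differentiable at p"
    using differentiable_exp_scaled[OF diff[OF \<omega> p], of "1/2"] by simp
  have r: "(\<lambda>q. exp (\<omega> q / 2) / (A q)\<^sup>2) differentiable at p" "(\<lambda>q. exp (\<omega> q / 2) / (B q)\<^sup>2) differentiable at p"
    using AB_nonzero[OF p] diff[OF smooth_AB(1) p] diff[OF smooth_AB(2) p]
    by (auto intro!: differentiable_divide e differentiable_power)
  note conj = mink_conj[OF det[OF \<tau> p]]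
  have F'1: "partial i (partial 1 F') p = partial i (\<lambda>q. (exp (\<omega> q / 2) / (A q)\<^sup>2) *\<^sub>R (P q ** E21 ** adj2 (P q))) p"
    and F'2: "partial i (partial 2 F') p = partial i (\<lambda>q. (exp (\<omega> q / 2) / (B q)\<^sup>2) *\<^sub>R (P q ** E12 ** adj2 (P q))) p" for i
    by (rule partial_cong[OF D p], erule partial_F')+
  have uu: "mink (partial 1 (partial 1 F') p) (N' p) = exp (\<omega> p / 2) / (A p)\<^sup>2 * mink (U p ** E21 - E21 ** U p) k'"
    unfolding F'1 partial_conj[OF dP partial_P(1)[OF p] UV_sl2(1) r(1)] N'_eq[OF p]
    by (simp add: conj mink_basis del: matrix_mult_linear)
  have uv: "mink (partial 1 (partial 2 F') p) (N' p) = exp (\<omega> p / 2) / (B p)\<^sup>2 * mink (U p ** E12 - E12 ** U p) k'"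
    unfolding F'2 partial_conj[OF dP partial_P(1)[OF p] UV_sl2(1) r(2)] N'_eq[OF p]
    by (simp add: conj mink_basis del: matrix_mult_linear)
  have vv: "mink (partial 2 (partial 2 F') p) (N' p) = exp (\<omega> p / 2) / (B p)\<^sup>2 * mink (V p ** E12 - E12 ** V p) k'"
    unfolding F'2 partial_conj[OF dP partial_P(2)[OF p] UV_sl2(2) r(2)] N'_eq[OF p]
    by (simp add: conj mink_basis del: matrix_mult_linear)
  have inv: "exp (\<omega> p / 2) * exp (- \<omega> p / 2) = 1" by (simp flip: exp_add)
  have "mink (U p ** E21 - E21 ** U p) k' = Q p * exp (- \<omega> p / 2)"
    "mink (V p ** E12 - E12 ** V p) k' = R p * exp (- \<omega> p / 2)"
    "mink (U p ** E12 - E12 ** U p) k' = H p / 2 * (B p / A p) * exp (\<omega> p / 2)"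
    by (simp_all add: mink_eq k'_def mat2_mult_nth lax_U_def lax_V_def spectral_eq[OF adm])
  note uu = uu[unfolded this] and uv = uv[unfolded this] and vv = vv[unfolded this]
  show "hopf_Q F' N' p = Q p / (A p)\<^sup>2" unfolding hopf_Q_def[of F'] uu using inv by (simp add: field_simps)
  show "hopf_R F' N' p = R p / (B p)\<^sup>2" unfolding hopf_R_def[of F'] vv using inv by (simp add: field_simps)
  show "null_surface.h F' N' p = exp (\<omega> p) * H p / (2 * A p * B p)"
    unfolding null_surface.h_def[OF null_F'] uv exp_half[symmetric]
    using AB_nonzero[OF p] by (simp add: field_simps power2_eq_square)
qed

text \<open>The new \<open>h\<close> is the old one divided by \<open>A * B\<close>, so the
  numerator of the Gauss curvature scales by \<open>1 / (A * B)^2\<close>, while the squared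
  conformal factor in its denominator scales by \<open>1 / (A * B)^4\<close>.\<close>

lemma curvatures_F':
  assumes p: "p \<in> D"
  shows "mean_curvature F' N' p = A p * B p * H p"
    and "gauss_curvature F' N' p = (A p)\<^sup>2 * (B p)\<^sup>2 * gauss_curvature F N p"
    and "1 / mean_curvature F' N' p = f (p $ 1) / A p + g (p $ 2) / B p"
proof -
  note nz = AB_nonzero[OF p]
  show H': "mean_curvature F' N' p = A p * B p * H p"
    unfolding null_surface.curvatures(1)[OF null_F' p] second_partials_F'[OF p] exp_\<omega>'[OF p]
    using nz by (simp add: field_simps power2_eq_square)
  show "gauss_curvature F' N' p = (A p)\<^sup>2 * (B p)\<^sup>2 * gauss_curvature F N p"
    unfolding null_surface.curvatures(2)[OF null_F' p] second_partials_F'[OF p] exp_\<omega>'[OF p] curvatures(2)[OF p]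
      h_eq[OF p]
    using nz by (simp add: field_simps power2_eq_square)
  show "1 / mean_curvature F' N' p = f (p $ 1) / A p + g (p $ 2) / B p"
    \<comment> \<open>The content is \<open>f * B + g * A = f + g\<close>, in which the two terms
      \<open>2 * \<tau> * f * g\<close> cancel.\<close>
    unfolding H' harmonic[OF p] using nz sum_nonzero[OF p]
    by (simp add: field_simps) (simp add: a_def b_def algebra_simps)
qed

lemma thimc_F': "thimc_surface D F' N'"
proof -
  interpret S': null_surface D F' N' \<omega>' by (rule null_F')
  have "partial 2 (partial 1 (\<lambda>q. 1 / mean_curvature F' N' q)) p = 0" if p: "p \<in> D" for p
  proof -
    have X: "smooth_on D (\<lambda>q. f (q $ 1) * inverse (A q))"
      by (rule smooth_on_bilinear[OF bounded_bilinear_mult D smooth_on_coordinate[OF D f]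
            smooth_on_inverse[OF D smooth_AB(1) AB_nonzero(1)]])
    have Y: "smooth_on D (\<lambda>q. g (q $ 2) * inverse (B q))"
      by (rule smooth_on_bilinear[OF bounded_bilinear_mult D smooth_on_coordinate[OF D g]
            smooth_on_inverse[OF D smooth_AB(2) AB_nonzero(2)]])
    have zero: "partial 2 (\<lambda>q. f (q $ 1) * inverse (A q)) q = 0" "partial 1 (\<lambda>q. g (q $ 2) * inverse (B q)) q = 0"
      if q: "q \<in> D" for q
    proof -
      have "(\<lambda>x. f x * inverse (1 + 2 * \<tau> * f x)) differentiable (at (q $ 1) within (\<lambda>p. p $ 1) ` D)"
        "(\<lambda>x. g x * inverse (1 - 2 * \<tau> * g x)) differentiable (at (q $ 2) within (\<lambda>p. p $ 2) ` D)"
        using AB_nonzero[OF q] differentiable_fg[OF q]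
        by (auto intro!: differentiable_inverse differentiable_add differentiable_diff differentiable_mult simp: a_def b_def)
      from this[THEN partial_coordinate(1)[OF D q]]
      show "partial 2 (\<lambda>q. f (q $ 1) * inverse (A q)) q = 0" "partial 1 (\<lambda>q. g (q $ 2) * inverse (B q)) q = 0"
        by (simp_all add: a_def[abs_def] b_def[abs_def])
    qed
    have "partial 1 (\<lambda>q. 1 / mean_curvature F' N' q) q = partial 1 (\<lambda>q. f (q $ 1) * inverse (A q)) q" if q: "q \<in> D" for q
    proof -
      have "partial 1 (\<lambda>q. 1 / mean_curvature F' N' q) q = partial 1 (\<lambda>q. f (q $ 1) * inverse (A q) + g (q $ 2) * inverse (B q)) q"
        by (rule partial_cong[OF D q]) (simp add: curvatures_F'(3) flip: divide_inverse)
      then show ?thesis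
        using partial_add[OF diff[OF X q] diff[OF Y q], where i=1] zero(2)[OF q] by simp
    qed
    then have "partial 2 (partial 1 (\<lambda>q. 1 / mean_curvature F' N' q)) p
        = partial 2 (partial 1 (\<lambda>q. f (q $ 1) * inverse (A q))) p"
      by (rule partial_cong[OF D p])
    \<comment> \<open>What is left depends on \<open>u\<close> alone; after swapping, the inner
      derivative in \<open>v\<close> vanishes on all of \<open>D\<close>.\<close>
    also have "\<dots> = partial 1 (partial 2 (\<lambda>q. f (q $ 1) * inverse (A q))) p"
      by (rule partial_commute[OF X D p])
    also have "\<dots> = partial 1 (\<lambda>q. 0) p"
      by (rule partial_cong[OF D p zero(1)])
    finally show ?thesis by simp
  qed
  then show ?thesis
    unfolding thimc_surface_def
    using S'.timelike[OF connected] S'.normal S'.null AB_nonzero nonzero curvatures_F'(1) by auto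
qed

lemma congruent_at_zero:
  assumes "\<tau> = 0"
  shows "\<exists>T. mink_isometry T \<and> (\<forall>p\<in>D. F' p = T (F p))"
proof (rule congruent_null_surfaces)
  have AB: "A p = 1" "B p = 1" for p by (simp_all add: a_def b_def assms)
  show "null_surface D F N \<omega>" by unfold_locales
  have "\<omega>' = \<omega>" by (simp add: \<omega>'_def[abs_def] AB)
  then show "null_surface D F' N' \<omega>" using null_F' by simp
  show "hopf_Q F' N' p = Q p" "hopf_R F' N' p = R p" "mean_curvature F' N' p = H p" if "p \<in> D" for p
    using second_partials_F'[OF that] curvatures_F'(1)[OF that] by (simp_all add: AB)
qed (rule connected)

end

end

theorem proposition3p4:
  fixes D :: "(real^2) set"
    and F N :: "real^2 \<Rightarrow> real^2^2"
    and \<omega> :: "real^2 \<Rightarrow> real"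
    and f g :: "real \<Rightarrow> real"
  assumes "simply_connected D"
    and "thimc_surface D F N"
    and "null_coordinates D F \<omega>"
    and "smooth_on ((\<lambda>p. p $ 1) ` D) f" and "smooth_on ((\<lambda>p. p $ 2) ` D) g"
    and "\<And>p. p \<in> D \<Longrightarrow> mean_curvature F N p = 1 / (f (p $ 1) + g (p $ 2))"
  shows
    "(\<forall>\<tau>\<in>admissible D f g. \<forall>p\<in>D.
        let U = lax_U F N \<omega> (spectral f g \<tau>); V = lax_V F N \<omega> (spectral f g \<tau>)
        in partial 1 V p - partial 2 U p + (U p ** V p - V p ** U p) = 0)
     \<and>
     (\<forall>J (\<Phi> :: real \<Rightarrow> real^2 \<Rightarrow> real^2^2).
        is_interval J \<and> interior J \<noteq> {} \<and> J \<subseteq> admissible D f g \<and>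
        (\<forall>\<tau>\<in>J. lax_solution D F N \<omega> (spectral f g \<tau>) (\<Phi> \<tau>) \<and> (\<forall>p\<in>D. det (\<Phi> \<tau> p) = 1)) \<and>
        smooth_on (J \<times> D) (\<lambda>(\<tau>, p). \<Phi> \<tau> p)
        \<longrightarrow>
        (\<forall>\<tau>\<in>J.
           let F' = sym_surface J \<Phi> \<tau>; N' = (\<lambda>p. Ad (\<Phi> \<tau> p) k')
           in thimc_surface D F' N' \<and>
              (\<forall>p\<in>D.
                 let a = 1 + 2 * \<tau> * f (p $ 1); b = 1 - 2 * \<tau> * g (p $ 2);
                     H = mean_curvature F N p; K = gauss_curvature F N p;
                     H' = mean_curvature F' N' p; K' = gauss_curvature F' N' p
                 in (\<forall>x. first_form F' p x x = exp (\<omega> p) / (a^2 * b^2) * (x $ 1) * (x $ 2)) \<and>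
                    1 / H' = f (p $ 1) / a + g (p $ 2) / b \<and>
                    hopf_Q F' N' p = hopf_Q F N p / a^2 \<and>
                    hopf_R F' N' p = hopf_R F N p / b^2 \<and>
                    K' = a^2 * b^2 * K \<and>
                    (K \<noteq> 0 \<longrightarrow> H'^2 / K' = H^2 / K))) \<and>
        (0 \<in> J \<longrightarrow> (\<exists>T. mink_isometry T \<and> (\<forall>p\<in>D. sym_surface J \<Phi> 0 p = T (F p)))))"
proof -
  interpret S: null_thimc_surface D F N \<omega> f g
  proof
    show "open D" "F ` D \<subseteq> sl2" "smooth_on D F" "unit_normal_field D F N" "connected D"
      using assms(2) unfolding thimc_surface_def timelike_surface_def by blast+
    show "mean_curvature F N p \<noteq> 0" if "p \<in> D" for p
      using assms(2) that unfolding thimc_surface_def by blast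
  qed (rule assms(3-6), assumption?)+
  show ?thesis
    unfolding Let_def
  proof (intro conjI allI impI, goal_cases)
    case 1
    show ?case by (intro ballI S.compatibility)
  next
    case (2 J \<Phi>)
    then have J: "is_interval J" "interior J \<noteq> {}" "J \<subseteq> admissible D f g"
      and sol: "\<And>t. t \<in> J \<Longrightarrow> lax_solution D F N \<omega> (spectral f g t) (\<Phi> t)"
      and det: "\<And>t p. t \<in> J \<Longrightarrow> p \<in> D \<Longrightarrow> det (\<Phi> t p) = 1"
      and \<Phi>: "smooth_on (J \<times> D) (\<lambda>(t, p). \<Phi> t p)"
      by blast+
    note J_\<Phi> = J sol det \<Phi>
    note AB = S.a_def S.b_def
    show ?case
    proof (intro ballI conjI allI impI, goal_cases)
      case (1 \<tau>)
      show ?case by (rule S.thimc_F'[OF J_\<Phi> 1])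
    next
      case (2 \<tau> p x)
      show ?case using S.first_form_F'[OF J_\<Phi> 2] unfolding AB .
    next
      case (3 \<tau> p)
      show ?case using S.curvatures_F'(3)[OF J_\<Phi> 3] unfolding AB .
    next
      case (4 \<tau> p)
      show ?case using S.second_partials_F'(1)[OF J_\<Phi> 4] unfolding AB .
    next
      case (5 \<tau> p)
      show ?case using S.second_partials_F'(2)[OF J_\<Phi> 5] unfolding AB .
    next
      case (6 \<tau> p)
      show ?case using S.curvatures_F'(2)[OF J_\<Phi> 6] unfolding AB .
    next
      case (7 \<tau> p)
      \<comment> \<open>\<open>H'^2\<close> and \<open>K'\<close> carry the same factor
        \<open>a^2 * b^2\<close>; admissibility of \<tau> allows it to be cancelled in the
        quotient.\<close>
      have "S.a \<tau> p \<noteq> 0" "S.b \<tau> p \<noteq> 0" using S.ab_nonzero J(3) 7 by blast+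
      then show ?case
        using S.curvatures_F'(1,2)[OF J_\<Phi> 7(1,2)] by (simp add: power_mult_distrib)
    qed
  next
    case (3 J \<Phi>)
    then show ?case by (intro S.congruent_at_zero[of J \<Phi> 0]) auto
  qed
qed

end
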